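(* Let $K\in End_{\mathcal A}^{*}(\mathcal H)$ and let $\{T_w\}_{w\in\Omega}$ be a continuous $K$-operator frame for $End_{\mathcal A}^{*}(\mathcal H)$ with bounds $A$ and $B$. Let $\{R_w\}_{w\in\Omega}\subset End_{\mathcal A}^{*}(\mathcal H)$ and let $\alpha,\beta\ge0$ be such that $0\le\alpha+\frac{\beta}{A}<1$. If for all $x\in\mathcal H$ $$\Big\|\int_\Omega\langle(T_w-R_w)x,(T_w-R_w)x\rangle_{\mathcal A}\,d\mu(w)\Big\|\le\alpha\Big\|\int_\Omega\langle T_wx,T_wx\rangle_{\mathcal A}\,d\mu(w)\Big\|+\beta\,\|\langle K^*x,K^*x\rangle_{\mathcal A}\|,$$ then $\{R_w\}_{w\in\Omega}$ is a continuous $K$-operator frame with bounds $A\Big(1-\sqrt{\alpha+\frac{\beta}{A}}\Big)^2$ and $B\Big(1+\sqrt{\alpha+\frac{\beta}{A}}\Big)^2$.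
   Context: $\mathcal A$ is a unital $C^*$-algebra, $\mathcal H$ is a (left) Hilbert $\mathcal A$-module with $\mathcal A$-valued inner product $\langle\cdot,\cdot\rangle_{\mathcal A}$ ($\mathcal A$-linear in the first variable) and norm $\|x\|=\|\langle x,x\rangle_{\mathcal A}\|^{1/2}$, and $End_{\mathcal A}^{*}(\mathcal H)$ is the set of adjointable operators $\mathcal H\to\mathcal H$. $(\Omega,\mu)$ is a measure space; integrals of Banach-space-valued functions are Bochner integrals. Inequalities between elements of $\mathcal A$ refer to the order given by the positive cone $\mathcal A^+$. For $K\in End_{\mathcal A}^{*}(\mathcal H)$, a family $\{T_w\}_{w\in\Omega}\subset End_{\mathcal A}^{*}(\mathcal H)$ is a continuous $K$-operator frame for $End_{\mathcal A}^{*}(\mathcal H)$ with (lower and upper) bounds $A,B>0$ if for every $x\in\mathcal H$, $A\langle K^*x,K^*x\rangle_{\mathcal A}\le\int_\Omega\langle T_wx,T_wx\rangle_{\mathcal A}\,d\mu(w)\le B\langle x,x\rangle_{\mathcal A}$. It is called a continuous $K$-operator frame if such $A,B>0$ exist. Convention: for all families of operators considered, $w\mapsto T_wx$ and $w\mapsto R_wx$ are measurable for each $x\in\mathcal H$, and an inequality involving integrals includes the assertion that these integrals exist. *)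

theory Defs
  imports "HOL-Analysis.Analysis"
begin

section \<open>Unital C*-algebras\<close>

text \<open>
  As usual for unital Banach algebras, the unit has norm one (so the algebra is nonzero).
  The real scalar multiplication inherited from the library classes is the restriction of the
  complex one.
\<close>

class cstar_algebra = real_normed_algebra_1 + banach +
  fixes scaleC :: "complex \<Rightarrow> 'a \<Rightarrow> 'a"
    and star :: "'a \<Rightarrow> 'a"
  assumes scaleC_add_right: "scaleC c (x + y) = scaleC c x + scaleC c y"
    and scaleC_add_left: "scaleC (c + d) x = scaleC c x + scaleC d x"
    and scaleC_scaleC: "scaleC c (scaleC d x) = scaleC (c * d) x"
    and scaleC_of_real: "scaleC (complex_of_real r) x = r *\<^sub>R x"
    and scaleC_mult_left: "scaleC c x * y = scaleC c (x * y)"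
    and scaleC_mult_right: "x * scaleC c y = scaleC c (x * y)"
    and norm_scaleC: "norm (scaleC c x) = cmod c * norm x"
    and star_add: "star (x + y) = star x + star y"
    and star_scaleC: "star (scaleC c x) = scaleC (cnj c) (star x)"
    and star_mult: "star (x * y) = star y * star x"
    and star_star: "star (star x) = x"
    and norm_star_mult_self: "norm (star x * x) = (norm x)\<^sup>2"

definition cstar_spectrum :: "'a::cstar_algebra \<Rightarrow> complex set" where
  "cstar_spectrum a = {z. \<not> (\<exists>b. b * (scaleC z 1 - a) = 1 \<and> (scaleC z 1 - a) * b = 1)}"

definition cstar_positive :: "'a::cstar_algebra \<Rightarrow> bool" where
  "cstar_positive a \<longleftrightarrow> star a = a \<and> cstar_spectrum a \<subseteq> complex_of_real ` {0..}"

definition cstar_le :: "'a::cstar_algebra \<Rightarrow> 'a \<Rightarrow> bool" (infix "\<sqsubseteq>\<^sub>C" 50) where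
  "a \<sqsubseteq>\<^sub>C b \<longleftrightarrow> cstar_positive (b - a)"


section \<open>Hilbert C*-modules and adjointable operators\<close>

text \<open>
  The complex vector space structure of the module is \<open>z x = act (scaleC z 1) x\<close>. The real part
  of it and the norm are those of the type, whose completeness is the class \<open>banach\<close>.
\<close>

locale hilbert_module =
  fixes act :: "'a::cstar_algebra \<Rightarrow> 'h::banach \<Rightarrow> 'h"
    and ip :: "'h \<Rightarrow> 'h \<Rightarrow> 'a"
  assumes act_add_right: "act a (x + y) = act a x + act a y"
    and act_add_left: "act (a + b) x = act a x + act b x"
    and act_act: "act a (act b x) = act (a * b) x"
    and act_one: "act 1 x = x"
    and act_scaleR: "act (r *\<^sub>R 1) x = r *\<^sub>R x"
    and ip_add_left: "ip (x + y) z = ip x z + ip y z"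
    and ip_act_left: "ip (act a x) y = a * ip x y"
    and ip_star: "star (ip x y) = ip y x"
    and ip_self_positive: "cstar_positive (ip x x)"
    and ip_self_eq_0: "ip x x = 0 \<Longrightarrow> x = 0"
    and norm_eq_sqrt_ip: "norm x = sqrt (norm (ip x x))"

text \<open>
  Linearity over the algebra and boundedness of adjointable maps are consequences of the
  existence of an adjoint.
\<close>

definition is_adjoint :: "('h \<Rightarrow> 'h \<Rightarrow> 'a) \<Rightarrow> ('h \<Rightarrow> 'h) \<Rightarrow> ('h \<Rightarrow> 'h) \<Rightarrow> bool" where
  "is_adjoint ip T S \<longleftrightarrow> (\<forall>x y. ip (T x) y = ip x (S y))"

definition adjointable :: "('h \<Rightarrow> 'h \<Rightarrow> 'a) \<Rightarrow> ('h \<Rightarrow> 'h) \<Rightarrow> bool" where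
  "adjointable ip T \<longleftrightarrow> (\<exists>S. is_adjoint ip T S)"

definition module_adjoint :: "('h \<Rightarrow> 'h \<Rightarrow> 'a) \<Rightarrow> ('h \<Rightarrow> 'h) \<Rightarrow> 'h \<Rightarrow> 'h" where
  "module_adjoint ip T = (THE S. is_adjoint ip T S)"


section \<open>Bochner integration in arbitrary Banach spaces\<close>

text \<open>
  The library's Bochner integral is confined to second countable spaces. The definition below is
  the same one with Borel measurability replaced by strong measurability; this makes no difference
  in the second countable case (up to null sets), and is what Bochner integrability requires in
  general.
\<close>

definition strongly_measurable :: "'w measure \<Rightarrow> ('w \<Rightarrow> 'b::banach) \<Rightarrow> bool" where
  "strongly_measurable M f \<longleftrightarrow>
    (\<exists>s. (\<forall>i. simple_function M (s i)) \<and> (AE w in M. (\<lambda>i. s i w) \<longlonglongrightarrow> f w))"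

definition has_bochner :: "'w measure \<Rightarrow> ('w \<Rightarrow> 'b::banach) \<Rightarrow> 'b \<Rightarrow> bool" where
  "has_bochner M f I \<longleftrightarrow> strongly_measurable M f \<and>
    (\<exists>s. (\<forall>i. Bochner_Integration.simple_bochner_integrable M (s i)) \<and>
      (\<lambda>i. \<integral>\<^sup>+ w. ennreal (norm (f w - s i w)) \<partial>M) \<longlonglongrightarrow> 0 \<and>
      (\<lambda>i. Bochner_Integration.simple_bochner_integral M (s i)) \<longlonglongrightarrow> I)"

definition bochner_integrable :: "'w measure \<Rightarrow> ('w \<Rightarrow> 'b::banach) \<Rightarrow> bool" where
  "bochner_integrable M f \<longleftrightarrow> (\<exists>I. has_bochner M f I)"

definition bochner :: "'w measure \<Rightarrow> ('w \<Rightarrow> 'b::banach) \<Rightarrow> 'b" where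
  "bochner M f = (THE I. has_bochner M f I)"


section \<open>Continuous K-operator frames\<close>

definition operator_family ::
  "('h::banach \<Rightarrow> 'h \<Rightarrow> 'a) \<Rightarrow> 'w measure \<Rightarrow> ('w \<Rightarrow> 'h \<Rightarrow> 'h) \<Rightarrow> bool" where
  "operator_family ip M T \<longleftrightarrow>
    (\<forall>w\<in>space M. adjointable ip (T w)) \<and> (\<forall>x. strongly_measurable M (\<lambda>w. T w x))"

definition continuous_K_operator_frame ::
  "('h::banach \<Rightarrow> 'h \<Rightarrow> 'a::cstar_algebra) \<Rightarrow> 'w measure \<Rightarrow> ('h \<Rightarrow> 'h) \<Rightarrow>
    ('w \<Rightarrow> 'h \<Rightarrow> 'h) \<Rightarrow> real \<Rightarrow> real \<Rightarrow> bool" where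
  "continuous_K_operator_frame ip M K T A B \<longleftrightarrow>
    operator_family ip M T \<and> A > 0 \<and> B > 0 \<and>
    (\<forall>x. bochner_integrable M (\<lambda>w. ip (T w x) (T w x)) \<and>
      A *\<^sub>R ip (module_adjoint ip K x) (module_adjoint ip K x)
        \<sqsubseteq>\<^sub>C bochner M (\<lambda>w. ip (T w x) (T w x)) \<and>
      bochner M (\<lambda>w. ip (T w x) (T w x)) \<sqsubseteq>\<^sub>C B *\<^sub>R ip x x)"

end

theory Submission
  imports Defs
begin

text \<open>
  Put \<open>\<lambda> = \<alpha> + \<beta> / A\<close> and write \<open>|u|\<^sup>2\<close> for the algebra-valued \<open>\<langle>u, u\<rangle>\<close>. The lower
  frame bound of \<open>T\<close> gives \<open>A \<parallel>|K\<^sup>*x|\<^sup>2\<parallel> \<le> \<parallel>\<integral> |T\<^sub>w x|\<^sup>2\<parallel>\<close>, so the perturbation hypothesis says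
  \<open>\<parallel>\<integral> |(T\<^sub>w - R\<^sub>w) x|\<^sup>2\<parallel> \<le> \<lambda> \<parallel>\<integral> |T\<^sub>w x|\<^sup>2\<parallel>\<close>. The expression \<open>\<parallel>\<integral> |u\<^sub>w|\<^sup>2\<parallel>^(1/2)\<close> satisfies the triangle
  inequality (\<open>sqrt_norm_bochner_ip_add_le\<close>), and hence, for every \<open>x\<close>,
  \<open>(1 - \<surd>\<lambda>)\<^sup>2 \<parallel>\<integral> |T\<^sub>w x|\<^sup>2\<parallel> \<le> \<parallel>\<integral> |R\<^sub>w x|\<^sup>2\<parallel> \<le> (1 + \<surd>\<lambda>)\<^sup>2 \<parallel>\<integral> |T\<^sub>w x|\<^sup>2\<parallel>\<close>.
  With the bounds for \<open>T\<close> these are the desired frame inequalities, but only between norms.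

  The passage from norms back to the order of the algebra rests on module linearity: replacing \<open>x\<close>
  by \<open>c x\<close> turns each of the elements \<open>a\<close> being compared into \<open>c a c\<^sup>*\<close>. So it is enough that
  positive elements satisfy \<open>q \<le> p\<close> as soon as \<open>\<parallel>c q c\<parallel> \<le> \<parallel>c p c\<parallel>\<close> for all self-adjoint \<open>c\<close>
  (\<open>cstar_le_if_conj_norm_le\<close>). To see this, take \<open>c = (p + \<epsilon>)^(-1/2)\<close>: then \<open>c p c \<le> 1\<close>, so
  \<open>\<parallel>c q c\<parallel> \<le> 1\<close>, so \<open>c q c \<le> 1\<close>, and conjugating with \<open>c\<^sup>-\<^sup>1\<close> gives \<open>q \<le> p + \<epsilon>\<close>.

  Since positivity is defined through the spectrum, this needs a little C*-algebra theory, which is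
  developed without Gelfand duality or the spectral radius formula. Its core is that the norm of
  a self-adjoint element is attained in absolute value on its spectrum (\<open>norm_in_spectrum\<close>); it
  makes positivity of a self-adjoint \<open>a\<close> equivalent to \<open>\<parallel>t - a\<parallel> \<le> t\<close> for one, or every,
  \<open>t \<ge> \<parallel>a\<parallel>\<close>, from which one reads off that the positive elements form a closed convex cone on
  which the norm is monotone. Inverse square roots come from the binomial series.

  For the Bochner integral one needs linearity, integrability of strongly measurable functions with
  integrable norm (to integrate \<open>|R\<^sub>w x|\<^sup>2\<close>), and that the integral of a function with values in a
  closed convex cone lies in the cone.
\<close>

section \<open>The involution and complex scalars\<close>

lemma star_zero [simp]: "star (0::'a::cstar_algebra) = 0"
  using star_add[of "0::'a" 0] by simp

lemma star_minus: "star (- x) = - star (x::'a::cstar_algebra)"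
  using star_add[of x "- x"] by (simp add: eq_neg_iff_add_eq_0 add.commute)

lemma star_diff: "star (x - y) = star x - star (y::'a::cstar_algebra)"
  using star_add[of x "- y"] by (simp add: star_minus)

lemma star_one [simp]: "star (1::'a::cstar_algebra) = 1"
  by (metis mult.left_neutral star_mult star_star mult.right_neutral)

lemma star_scaleR: "star (r *\<^sub>R x) = r *\<^sub>R star (x::'a::cstar_algebra)"
  by (metis complex_cnj_complex_of_real scaleC_of_real star_scaleC)

text \<open>
  The identity \<open>\<parallel>x\<^sup>* x\<parallel> = \<parallel>x\<parallel>\<^sup>2\<close> is bounded by \<open>\<parallel>x\<^sup>*\<parallel> \<parallel>x\<parallel>\<close>. Applied to \<open>x\<^sup>*\<close> as well, this makes the
  involution isometric.
\<close>

lemma norm_le_norm_star: "norm x \<le> norm (star (x::'a::cstar_algebra))"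
proof -
  have "norm x * norm x \<le> norm (star x) * norm x"
    using norm_star_mult_self[of x] norm_mult_ineq[of "star x" x] by (simp add: power2_eq_square)
  then show ?thesis
    by (metis mult_right_le_imp_le norm_ge_zero order_le_less)
qed

lemma norm_star [simp]: "norm (star x) = norm (x::'a::cstar_algebra)"
  using norm_le_norm_star[of x] norm_le_norm_star[of "star x"] by (simp add: star_star)

lemma bounded_linear_star: "bounded_linear (star :: 'a::cstar_algebra \<Rightarrow> 'a)"
  by (rule bounded_linear_intro[where K=1]) (auto simp: star_add star_scaleR)

lemma star_power: "star (x ^ n) = star (x::'a::cstar_algebra) ^ n"
  by (induction n) (auto simp: star_mult power_commutes)

lemma scaleC_zero_right [simp]: "scaleC c (0::'a::cstar_algebra) = 0"
  using scaleC_add_right[of c "0::'a" 0] by simp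

lemma scaleC_zero_left [simp]: "scaleC 0 (x::'a::cstar_algebra) = 0"
  using scaleC_add_left[of 0 0 x] by simp

lemma scaleC_one [simp]: "scaleC 1 (x::'a::cstar_algebra) = x"
  using scaleC_of_real[of 1 x] by simp

lemma scaleC_minus_left: "scaleC (- c) x = - scaleC c (x::'a::cstar_algebra)"
  using scaleC_add_left[of c "- c" x] by (simp add: eq_neg_iff_add_eq_0 add.commute)

lemma scaleC_minus_right: "scaleC c (- x) = - scaleC c (x::'a::cstar_algebra)"
  using scaleC_add_right[of c "x" "- x"] by (simp add: eq_neg_iff_add_eq_0 add.commute)

lemma scaleC_diff_right: "scaleC c (x - y) = scaleC c x - scaleC c (y::'a::cstar_algebra)"
  using scaleC_add_right[of c "x" "- y"] by (simp add: scaleC_minus_right)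

lemma scaleC_diff_left: "scaleC (c - d) x = scaleC c x - scaleC d (x::'a::cstar_algebra)"
  using scaleC_add_left[of c "- d" x] by (simp add: scaleC_minus_left)


section \<open>Invertible elements and the spectrum\<close>

definition invertible_element :: "'a::monoid_mult \<Rightarrow> bool" where
  "invertible_element x \<longleftrightarrow> (\<exists>y. y * x = 1 \<and> x * y = 1)"

lemma cstar_spectrum_iff: "z \<in> cstar_spectrum a \<longleftrightarrow> \<not> invertible_element (scaleC z 1 - a)"
  by (simp add: cstar_spectrum_def invertible_element_def)

lemma invertible_element_mult: "invertible_element x \<Longrightarrow> invertible_element y \<Longrightarrow> invertible_element (x * y)"
proof -
  assume "invertible_element x" "invertible_element y"
  then obtain u v where u: "u * x = 1" "x * u = 1" and v: "v * y = 1" "y * v = 1"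
    unfolding invertible_element_def by blast
  have "(v * u) * (x * y) = 1" "(x * y) * (v * u) = 1"
    using u v by (metis mult.assoc mult.left_neutral)+
  then show ?thesis unfolding invertible_element_def by blast
qed

lemma invertible_element_scaleC:
  assumes "c \<noteq> 0" shows "invertible_element (scaleC c x) \<longleftrightarrow> invertible_element (x::'a::cstar_algebra)"
proof -
  have *: "invertible_element (scaleC c x)" if "invertible_element x" "c \<noteq> 0" for c and x :: 'a
  proof -
    obtain y where "y * x = 1" "x * y = 1" using \<open>invertible_element x\<close> unfolding invertible_element_def by blast
    then have "scaleC (1/c) y * scaleC c x = 1" "scaleC c x * scaleC (1/c) y = 1"
      using that by (simp_all add: scaleC_mult_left scaleC_mult_right scaleC_scaleC)
    then show ?thesis unfolding invertible_element_def by blast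
  qed
  show ?thesis using *[of x c] *[of "scaleC c x" "1/c"] assms by (auto simp: scaleC_scaleC)
qed

lemma invertible_element_scaleR:
  "c \<noteq> 0 \<Longrightarrow> invertible_element (c *\<^sub>R x) \<longleftrightarrow> invertible_element (x::'a::cstar_algebra)"
  using invertible_element_scaleC[of "complex_of_real c" x] by (simp add: scaleC_of_real)

lemma invertible_element_minus: "invertible_element (- x) \<longleftrightarrow> invertible_element (x::'a::ring_1)"
  unfolding invertible_element_def by (metis minus_mult_minus minus_minus)

text \<open>
  The Neumann series, used both to see that elements near the unit are invertible and to evaluate
  the square of the binomial series of \<open>(1 - x)^(-1/2)\<close>.
\<close>

lemma geometric_suminf_mult:
  fixes x :: "'a::{real_normed_algebra_1, banach}"
  assumes "norm x < 1"
  shows "suminf (\<lambda>n. x ^ n) * (1 - x) = 1" "(1 - x) * suminf (\<lambda>n. x ^ n) = 1"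
proof -
  have s: "summable (\<lambda>n. x ^ n)"
    by (rule complete_algebra_summable_geometric[OF assms])
  have t: "(\<lambda>n. x ^ n) \<longlonglongrightarrow> 0" using s by (rule summable_LIMSEQ_zero)
  have e1: "(\<lambda>n. x ^ n - x ^ Suc n) sums (1 - 0)"
    using telescope_sums'[OF t] by simp
  have "(\<lambda>n. x ^ n * (1 - x)) sums (suminf (\<lambda>n. x ^ n) * (1 - x))"
    using s by (intro sums_mult2 summable_sums)
  moreover have "(\<lambda>n. (1 - x) * x ^ n) sums ((1 - x) * suminf (\<lambda>n. x ^ n))"
    using s by (intro sums_mult summable_sums)
  moreover have "x ^ n * (1 - x) = x ^ n - x ^ Suc n" "(1 - x) * x ^ n = x ^ n - x ^ Suc n" for n
    by (simp_all add: algebra_simps power_commutes)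
  ultimately show "suminf (\<lambda>n. x ^ n) * (1 - x) = 1" "(1 - x) * suminf (\<lambda>n. x ^ n) = 1"
    using sums_unique2[OF e1] by simp_all
qed

lemma invertible_element_one_minus:
  fixes x :: "'a::{real_normed_algebra_1, banach}"
  assumes "norm x < 1"
  shows "invertible_element (1 - x)"
  using geometric_suminf_mult[OF assms] unfolding invertible_element_def by blast

lemma cmod_spectrum_le:
  assumes "z \<in> cstar_spectrum a" shows "cmod z \<le> norm a"
proof (rule ccontr)
  assume *: "\<not> ?thesis"
  then have z: "z \<noteq> 0" by auto
  have "norm (scaleC (1/z) a) < 1"
    using * z by (simp add: norm_scaleC norm_divide divide_simps)
  then have "invertible_element (scaleC z (1 - scaleC (1/z) a))"
    using invertible_element_one_minus invertible_element_scaleC[OF z] by blast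
  then show False using assms z by (simp add: cstar_spectrum_iff scaleC_diff_right scaleC_scaleC)
qed


section \<open>Spectrum and norm of self-adjoint elements\<close>

text \<open>
  For commuting self-adjoint \<open>x\<close> and \<open>y\<close> the element \<open>x + \<i>y\<close> is normal and
  \<open>(x + \<i>y)\<^sup>* (x + \<i>y) = x\<^sup>2 + y\<^sup>2\<close>. This is how the C*-identity controls sums of squares before
  anything is known about positivity.
\<close>

lemma norm_add_ii:
  fixes x y :: "'a::cstar_algebra"
  assumes "star x = x" "star y = y" "x * y = y * x"
  shows "(norm (x + scaleC \<i> y))\<^sup>2 = norm (x * x + y * y)"
proof -
  have "star (x + scaleC \<i> y) * (x + scaleC \<i> y) = x * x + y * y"
    using assms by (simp add: star_add star_scaleC algebra_simps scaleC_mult_left scaleC_mult_right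
      scaleC_scaleC scaleC_minus_left scaleC_diff_right)
  then show ?thesis by (metis norm_star_mult_self)
qed

text \<open>
  If \<open>z\<close> is in the spectrum of \<open>a\<close>, then \<open>z + \<i>\<tau>\<close> is in that of \<open>a + \<i>\<tau>\<close> for every real \<open>\<tau>\<close>, and
  the squared norm of the latter is at most \<open>\<parallel>a\<parallel>\<^sup>2 + \<tau>\<^sup>2\<close>. As \<open>|z + \<i>\<tau>|\<^sup>2\<close> contains the term
  \<open>2 \<tau> Im z\<close>, letting \<open>\<tau>\<close> grow with the sign of \<open>Im z\<close> excludes \<open>Im z \<noteq> 0\<close>.
\<close>

lemma spectrum_real:
  fixes a :: "'a::cstar_algebra"
  assumes "star a = a" "z \<in> cstar_spectrum a"
  shows "Im z = 0"
proof (rule ccontr)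
  assume t: "Im z \<noteq> 0"
  have *: "2 * Im z * \<tau> \<le> (norm a)\<^sup>2" for \<tau> :: real
  proof -
    have "z + \<i> * of_real \<tau> \<in> cstar_spectrum (a + scaleC \<i> (\<tau> *\<^sub>R 1))"
      using assms(2) by (simp add: cstar_spectrum_iff scaleC_add_left scaleC_scaleC
        flip: scaleC_of_real)
    then have "cmod (z + \<i> * of_real \<tau>) \<le> norm (a + scaleC \<i> (\<tau> *\<^sub>R 1))"
      by (rule cmod_spectrum_le)
    then have "(cmod (z + \<i> * of_real \<tau>))\<^sup>2 \<le> (norm (a + scaleC \<i> (\<tau> *\<^sub>R 1)))\<^sup>2"
      by (intro power_mono) auto
    also have "\<dots> = norm (a * a + (\<tau> * \<tau>) *\<^sub>R 1)"
      using assms by (subst norm_add_ii) (auto simp: star_scaleR)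
    also have "\<dots> \<le> norm a * norm a + \<tau> * \<tau>"
      using norm_triangle_ineq[of "a * a" "(\<tau> * \<tau>) *\<^sub>R 1"] norm_mult_ineq[of a a]
      by (simp add: abs_mult_self_eq)
    finally have "(Re z)\<^sup>2 + (Im z + \<tau>)\<^sup>2 \<le> (norm a)\<^sup>2 + \<tau>\<^sup>2"
      by (simp only: cmod_power2) (simp add: power2_eq_square)
    then have "(Re z)\<^sup>2 + (Im z)\<^sup>2 + 2 * Im z * \<tau> \<le> (norm a)\<^sup>2"
      by (simp add: power2_sum)
    then show ?thesis using zero_le_power2[of "Re z"] zero_le_power2[of "Im z"] by linarith
  qed
  \<comment> \<open>This \<open>\<tau>\<close> makes the left-hand side of the bound exceed the right-hand side by one.\<close>
  have "2 * Im z * (((norm a)\<^sup>2 + 1) / (2 * Im z)) = (norm a)\<^sup>2 + 1" using t by simp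
  then show False using *[of "((norm a)\<^sup>2 + 1) / (2 * Im z)"] by linarith
qed

text \<open>
  \<open>2 x\<close> is the sum of \<open>x + \<i>y\<close> and its adjoint, which have the same norm.
\<close>

lemma norm_le_norm_add_ii:
  fixes x y :: "'a::cstar_algebra"
  assumes "star x = x" "star y = y"
  shows "norm x \<le> norm (x + scaleC \<i> y)"
proof -
  have "norm (2 *\<^sub>R x) = norm ((x + scaleC \<i> y) + star (x + scaleC \<i> y))"
    using assms by (simp add: star_add star_scaleC scaleC_minus_left scaleR_2)
  also have "\<dots> \<le> norm (x + scaleC \<i> y) + norm (x + scaleC \<i> y)"
    by (metis norm_triangle_ineq norm_star)
  finally show ?thesis by simp
qed

lemma norm_square_le_norm_sum_squares:
  fixes x y :: "'a::cstar_algebra"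
  assumes "star x = x" "star y = y" "x * y = y * x"
  shows "(norm y)\<^sup>2 \<le> norm (x * x + y * y)"
  using norm_add_ii[OF assms(2,1)] norm_le_norm_add_ii[OF assms(2,1)] assms(3)
  by (metis add.commute norm_ge_zero power_mono)

lemma norm_selfadjoint_square:
  fixes x :: "'a::cstar_algebra"
  shows "star x = x \<Longrightarrow> norm (x * x) = (norm x)\<^sup>2"
  by (metis norm_star_mult_self)

lemma norm_selfadjoint_power2:
  fixes x :: "'a::cstar_algebra"
  assumes "star x = x" shows "norm (x ^ (2 ^ k)) = norm x ^ (2 ^ k)"
proof (induction k)
  case (Suc k)
  have "norm (x ^ (2 ^ Suc k)) = norm (x ^ (2 ^ k) * x ^ (2 ^ k))"
    by (simp add: mult_2 power_add)
  also have "\<dots> = (norm (x ^ (2 ^ k)))\<^sup>2"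
    using assms by (intro norm_selfadjoint_square) (simp add: star_power)
  finally show ?case using Suc by (simp add: power_mult power2_eq_square mult_2 power_add)
qed simp

text \<open>
  From \<open>(1 + x\<^sup>2)\<^sup>2 = (1 - x\<^sup>2)\<^sup>2 + (2x)\<^sup>2\<close>: up to the factor \<open>y\<^sup>2\<close> this exhibits the square of
  \<open>y (1 + x\<^sup>2)\<close> as a sum of two squares, one of which is that of \<open>2 y x\<close>. For numbers it is the
  inequality \<open>2x \<le> 1 + x\<^sup>2\<close>.
\<close>

lemma norm_mult_one_plus_square:
  fixes x y :: "'a::cstar_algebra"
  assumes x: "star x = x" and y: "star y = y" and c: "x * y = y * x"
  shows "2 * norm (y * x) \<le> norm (y * (1 + x * x))"
proof -
  have c2: "x * (y * z) = y * (x * z)" for z using c by (metis mult.assoc)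
  have four: "4 *\<^sub>R e = e + (e + (e + e))" for e :: 'a
    using scaleR_add_left[of 2 2 e] by (simp add: scaleR_2 add.assoc)
  \<comment> \<open>The two squares whose sum is the square of \<open>y (1 + x\<^sup>2)\<close>.\<close>
  define u where "u = y * (1 - x * x)"
  define v where "v = 2 *\<^sub>R (y * x)"
  have w: "star (y * (1 + x * x)) = y * (1 + x * x)"
    using x y by (simp add: star_add star_mult algebra_simps c2 c)
  have "star u = u" "star v = v" "u * v = v * u"
    using x y by (simp_all add: u_def v_def star_diff star_mult star_scaleR algebra_simps c2 c)
  then have "(norm v)\<^sup>2 \<le> norm (u * u + v * v)" by (rule norm_square_le_norm_sum_squares)
  also have "u * u + v * v = (y * (1 + x * x)) * (y * (1 + x * x))"
    by (simp add: u_def v_def algebra_simps c2 c four)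
  also have "norm \<dots> = (norm (y * (1 + x * x)))\<^sup>2" by (rule norm_selfadjoint_square[OF w])
  finally have "norm v \<le> norm (y * (1 + x * x))" by (rule power2_le_imp_le) simp
  then show ?thesis by (simp add: v_def)
qed

lemma sum_lessThan_add:
  fixes f :: "nat \<Rightarrow> 'b::comm_monoid_add"
  shows "(\<Sum>j<m + n. f j) = (\<Sum>j<m. f j) + (\<Sum>j<n. f (m + j))"
  by (induction n) (simp_all add: add.assoc)

text \<open>
  The sum of the first \<open>2^k\<close> powers of \<open>x\<^sup>2\<close> factors as the product of the \<open>1 + (x^2^j)\<^sup>2\<close> with
  \<open>j < k\<close>. By the preceding inequality each factor may be replaced by \<open>2 x^2^j\<close> at the cost of
  decreasing the norm, and the product of the \<open>x^2^j\<close> is \<open>x^(2^k - 1)\<close>. The auxiliary factor \<open>y\<close>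
  collects those \<open>x^2^j\<close> that have already taken the place of a factor.
\<close>

lemma norm_geometric_sum:
  fixes x y :: "'a::cstar_algebra"
  assumes x: "star x = x" and "star y = y" "x * y = y * x"
  shows "2 ^ k * norm (y * x ^ (2 ^ k - 1)) \<le> norm (y * (\<Sum>j<2 ^ k. (x * x) ^ j))"
  using assms(2,3)
proof (induction k arbitrary: y)
  case (Suc k)
  define X where "X = x ^ 2 ^ k"
  define S where "S = (\<Sum>j<2 ^ k. (x * x) ^ j)"
  have xx: "(x * x) ^ j = x ^ (2 * j)" for j
    by (simp add: power_mult power2_eq_square)
  have X: "star X = X" "x * X = X * x" unfolding X_def using x
    by (simp_all add: star_power power_commutes)
  have S: "star S = S" unfolding S_def xx
    by (subst linear_sum[OF bounded_linear.linear[OF bounded_linear_star]]) (simp add: star_power x)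
  have XS: "X * S = S * X" unfolding S_def X_def xx sum_distrib_left sum_distrib_right
    by (intro sum.cong refl) (simp add: add.commute flip: power_add)
  have cm: "x ^ m * y = y * x ^ m" for m
    using Suc.prems(2) by (metis power_commuting_commutes)
  have Xy: "X * y = y * X" unfolding X_def by (rule cm)
  have Sy: "S * y = y * S" unfolding S_def xx by (simp add: sum_distrib_left sum_distrib_right cm)
  \<comment> \<open>With \<open>X = x^2^k\<close> this splits off the factor of the product with \<open>j = k\<close>; to the remaining
    product \<open>S\<close> the induction hypothesis applies with \<open>y X\<close> in place of \<open>y\<close>.\<close>
  have sum_double: "(\<Sum>j<2 ^ Suc k. (x * x) ^ j) = S * (1 + X * X)"
  proof -
    have "x ^ (2 * (2 ^ k + j)) = x ^ (2 * j) * (X * X)" for j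
    proof -
      have "2 * (2 ^ k + j) = 2 * j + (2 ^ k + 2 ^ k :: nat)" by simp
      then show ?thesis by (simp only: power_add X_def)
    qed
    then show ?thesis
      unfolding xx mult_2 power_Suc sum_lessThan_add S_def
      by (simp add: distrib_left sum_distrib_right mult_2)
  qed
  have "star (y * X) = y * X" using Suc.prems X Xy by (simp add: star_mult)
  moreover have "x * (y * X) = (y * X) * x" using Suc.prems(2) X(2) by (metis mult.assoc)
  ultimately have "2 ^ k * norm (y * X * x ^ (2 ^ k - 1)) \<le> norm (y * X * S)"
    unfolding S_def by (rule Suc.IH)
  moreover have "star (y * S) = y * S" using Suc.prems S Sy by (simp add: star_mult)
  moreover have "X * (y * S) = (y * S) * X" using Xy XS by (metis mult.assoc)
  moreover note norm_mult_one_plus_square[of X "y * S"]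
  moreover have "y * S * X = y * X * S" using XS by (simp add: mult.assoc)
  moreover have "y * X * x ^ (2 ^ k - 1) = y * x ^ (2 ^ Suc k - 1)"
  proof -
    have "2 ^ k + (2 ^ k - 1) = (2 ^ Suc k - 1 :: nat)" by (simp add: mult_2)
    then show ?thesis unfolding X_def by (metis mult.assoc power_add)
  qed
  ultimately show ?case using X(1) unfolding sum_double by (simp add: mult.assoc)
qed simp

text \<open>
  If \<open>1 - x\<^sup>2\<close> had an inverse \<open>c\<close>, the geometric sums \<open>c (1 - x^2^(k+1))\<close> would be bounded by
  \<open>2 \<parallel>c\<parallel>\<close>. But their norm is at least \<open>2^k \<parallel>x^(2^k - 1)\<parallel>\<close>, and powers of a self-adjoint element
  of norm one have norm one. This replaces the spectral radius formula for self-adjoint elements.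
\<close>

lemma one_minus_square_not_invertible_element:
  fixes x :: "'a::cstar_algebra"
  assumes x: "star x = x" "norm x = 1"
  shows "\<not> invertible_element (1 - x * x)"
proof
  assume "invertible_element (1 - x * x)"
  then obtain c where c: "c * (1 - x * x) = 1" unfolding invertible_element_def by blast
  have le1: "norm (x ^ n) \<le> 1" for n using norm_power_ineq[of x n] x by simp
  have ge1: "1 \<le> norm (x ^ (2 ^ k - 1))" for k :: nat
  proof -
    have "1 = norm (x ^ (2 ^ k))" using norm_selfadjoint_power2[OF x(1), of k] x(2) by simp
    also have "x ^ (2 ^ k) = x * x ^ (2 ^ k - 1)"
      by (metis power_Suc Suc_diff_1 zero_less_numeral zero_less_power)
    also have "norm \<dots> \<le> norm (x ^ (2 ^ k - 1))"
      using norm_mult_ineq[of x "x ^ (2 ^ k - 1)"] x by simp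
    finally show ?thesis .
  qed
  have "2 ^ k \<le> norm c * 2" for k :: nat
  proof -
    have tel: "(1 - z) * (\<Sum>j<n. z ^ j) = 1 - z ^ n" for z :: 'a and n
    proof (induction n)
      case (Suc n)
      have "(1 - z) * (\<Sum>j<Suc n. z ^ j) = (1 - z) * (\<Sum>j<n. z ^ j) + (1 - z) * z ^ n"
        by (simp add: distrib_left)
      then show ?case by (simp only: Suc) (simp add: left_diff_distrib)
    qed simp
    have "(\<Sum>j<2 ^ k. (x * x) ^ j) = c * ((1 - x * x) * (\<Sum>j<2 ^ k. (x * x) ^ j))"
      using c by (simp flip: mult.assoc)
    also have "\<dots> = c * (1 - (x * x) ^ (2 ^ k))" by (simp only: tel)
    also have "norm \<dots> \<le> norm c * norm (1 - (x * x) ^ (2 ^ k))" by (rule norm_mult_ineq)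
    also have "norm (1 - (x * x) ^ (2 ^ k)) \<le> 1 + norm ((x * x) ^ (2 ^ k))"
      using norm_triangle_ineq4[of 1] by (metis norm_one)
    also have "\<dots> \<le> 2" using le1[of "2 * 2 ^ k"] by (simp add: power_mult power2_eq_square)
    finally have u: "norm (\<Sum>j<2 ^ k. (x * x) ^ j) \<le> norm c * 2" by (simp add: mult_left_mono)
    have "2 ^ k * 1 \<le> 2 ^ k * norm (x ^ (2 ^ k - 1))" by (rule mult_left_mono[OF ge1]) simp
    moreover have "2 ^ k * norm (x ^ (2 ^ k - 1)) \<le> norm (\<Sum>j<2 ^ k. (x * x) ^ j)"
      using norm_geometric_sum[OF x(1), of 1 k] by simp
    ultimately show ?thesis using u by linarith
  qed
  moreover obtain k :: nat where "norm c * 2 < 2 ^ k"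
    using real_arch_pow[of 2 "norm c * 2"] by auto
  ultimately show False by (meson not_le)
qed

text \<open>
  After normalising to \<open>\<parallel>x\<parallel> = 1\<close>, one of the factors of the non-invertible element
  \<open>1 - x\<^sup>2 = (1 - x) (1 + x)\<close> is not invertible.
\<close>

lemma norm_in_spectrum:
  fixes a :: "'a::cstar_algebra"
  assumes a: "star a = a"
  shows "complex_of_real (norm a) \<in> cstar_spectrum a \<or> - complex_of_real (norm a) \<in> cstar_spectrum a"
proof (cases "a = 0")
  case True
  then show ?thesis by (simp add: cstar_spectrum_iff invertible_element_def)
next
  case False
  define N where "N = norm a"
  have N: "N > 0" using False by (simp add: N_def)
  define x where "x = (1 / N) *\<^sub>R a"
  have "star x = x" "norm x = 1" using a N by (simp_all add: x_def star_scaleR, simp add: N_def)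
  then have "\<not> invertible_element (1 - x * x)" by (rule one_minus_square_not_invertible_element)
  moreover have "1 - x * x = (1 - x) * (1 + x)" by (simp add: algebra_simps)
  ultimately have "\<not> invertible_element (1 - x) \<or> \<not> invertible_element (1 + x)" using invertible_element_mult by metis
  moreover have "N *\<^sub>R 1 - a = N *\<^sub>R (1 - x)" "- (N *\<^sub>R 1) - a = - (N *\<^sub>R (1 + x))"
    using N by (simp_all add: x_def algebra_simps)
  ultimately have "\<not> invertible_element (N *\<^sub>R 1 - a) \<or> \<not> invertible_element (- (N *\<^sub>R 1) - a)"
    using N by (metis invertible_element_scaleR invertible_element_minus less_irrefl)
  then show ?thesis unfolding N_def[symmetric]
    by (simp add: cstar_spectrum_iff scaleC_minus_left scaleC_of_real)
qed

lemma norm_le_if_spectrum_le: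
  fixes a :: "'a::cstar_algebra"
  assumes "star a = a" "\<And>z. z \<in> cstar_spectrum a \<Longrightarrow> cmod z \<le> r"
  shows "norm a \<le> r"
  using norm_in_spectrum[OF assms(1)] assms(2) by fastforce


section \<open>The cone of positive elements\<close>

lemma spectrum_shift:
  "z \<in> cstar_spectrum (t *\<^sub>R 1 - a) \<longleftrightarrow> of_real t - z \<in> cstar_spectrum a"
proof -
  have "scaleC (of_real t - z) 1 - a = - (scaleC z 1 - (t *\<^sub>R 1 - a))"
    by (simp add: scaleC_diff_left scaleC_of_real)
  then show ?thesis by (simp only: cstar_spectrum_iff invertible_element_minus)
qed

lemma cstar_positive_star: "cstar_positive a \<Longrightarrow> star a = a"
  by (simp add: cstar_positive_def)

lemma cstar_positive_spectrum:
  assumes "cstar_positive a" "z \<in> cstar_spectrum a"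
  obtains r where "r \<ge> 0" "z = of_real r" "r \<le> norm a"
proof -
  obtain r where r: "r \<ge> 0" "z = of_real r" using assms unfolding cstar_positive_def by auto
  moreover have "r \<le> norm a" using cmod_spectrum_le[OF assms(2)] r by simp
  ultimately show ?thesis using that by blast
qed

text \<open>
  The spectrum is real, and the disc of radius \<open>t\<close> around \<open>t\<close> meets the real axis only in
  nonnegative numbers.
\<close>

lemma cstar_positiveI:
  fixes a :: "'a::cstar_algebra"
  assumes "star a = a" "norm (t *\<^sub>R 1 - a) \<le> t"
  shows "cstar_positive a"
  unfolding cstar_positive_def
proof (intro conjI subsetI)
  fix z assume z: "z \<in> cstar_spectrum a"
  then have im: "Im z = 0" using spectrum_real assms(1) by blast
  have "of_real t - z \<in> cstar_spectrum (t *\<^sub>R 1 - a)" using z by (simp add: spectrum_shift)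
  then have "cmod (of_real t - z) \<le> t" using cmod_spectrum_le assms(2) by fastforce
  then have "Re z \<ge> 0" using complex_Re_le_cmod[of "of_real t - z"] by simp
  moreover have "z = complex_of_real (Re z)" using im by (simp add: complex_eq_iff)
  ultimately show "z \<in> complex_of_real ` {0..}" by (metis atLeast_iff imageI)
qed (fact assms(1))

text \<open>
  The converse of the previous criterion, valid for every \<open>t \<ge> \<parallel>a\<parallel>\<close>: the spectrum of \<open>t - a\<close> then
  lies in \<open>[0, t]\<close>. As \<open>t\<close> is arbitrary, the terms of a bounded sequence of positive elements
  satisfy the criterion with a common \<open>t\<close>, and so does their limit.
\<close>

lemma cstar_positive_norm:
  fixes a :: "'a::cstar_algebra"
  assumes a: "cstar_positive a" and t: "norm a \<le> t"
  shows "norm (t *\<^sub>R 1 - a) \<le> t"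
proof (rule norm_le_if_spectrum_le)
  show "star (t *\<^sub>R 1 - a) = t *\<^sub>R 1 - a"
    using cstar_positive_star[OF a] by (simp add: star_diff star_scaleR)
  fix z assume "z \<in> cstar_spectrum (t *\<^sub>R 1 - a)"
  then obtain r where r: "r \<ge> 0" "of_real t - z = of_real r" "r \<le> norm a"
    using cstar_positive_spectrum[OF a] by (metis spectrum_shift)
  then have "z = of_real (t - r)" by (simp add: algebra_simps)
  then show "cmod z \<le> t" using r t by (simp only: norm_of_real)
qed

lemma cstar_positive_add:
  fixes a b :: "'a::cstar_algebra"
  assumes "cstar_positive a" "cstar_positive b"
  shows "cstar_positive (a + b)"
proof (rule cstar_positiveI)
  show "star (a + b) = a + b" using assms by (simp add: star_add cstar_positive_star)
  have "(norm a + norm b) *\<^sub>R 1 - (a + b) = (norm a *\<^sub>R 1 - a) + (norm b *\<^sub>R 1 - b)"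
    by (simp add: algebra_simps)
  then show "norm ((norm a + norm b) *\<^sub>R 1 - (a + b)) \<le> norm a + norm b"
    using assms by (metis norm_triangle_mono cstar_positive_norm order_refl)
qed

lemma cstar_positive_scaleR:
  fixes a :: "'a::cstar_algebra"
  assumes "cstar_positive a" "r \<ge> 0"
  shows "cstar_positive (r *\<^sub>R a)"
proof (rule cstar_positiveI)
  show "star (r *\<^sub>R a) = r *\<^sub>R a" using assms by (simp add: star_scaleR cstar_positive_star)
  have "(r * norm a) *\<^sub>R 1 - r *\<^sub>R a = r *\<^sub>R (norm a *\<^sub>R 1 - a)"
    by (simp add: algebra_simps)
  then show "norm ((r * norm a) *\<^sub>R 1 - r *\<^sub>R a) \<le> r * norm a"
    using cstar_positive_norm[OF assms(1) order_refl] assms(2) by (simp add: mult_left_mono)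
qed

lemma cstar_positive_norm_minus:
  fixes a :: "'a::cstar_algebra"
  assumes "star a = a" "norm a \<le> t"
  shows "cstar_positive (t *\<^sub>R 1 - a)"
  using assms by (intro cstar_positiveI[of _ t]) (auto simp: star_diff star_scaleR)

lemma cstar_positive_zero: "cstar_positive (0::'a::cstar_algebra)"
  by (rule cstar_positiveI[of _ 0]) auto

lemma closed_cstar_positive: "closed {a::'a::cstar_algebra. cstar_positive a}"
  unfolding closed_sequential_limits
proof (intro allI impI, elim conjE)
  fix f :: "nat \<Rightarrow> 'a" and l
  assume f: "\<forall>n. f n \<in> {a. cstar_positive a}" and l: "f \<longlonglongrightarrow> l"
  obtain t where t: "\<And>n. norm (f n) \<le> t"
    using l convergent_imp_Bseq convergentI BseqE by metis
  have "(\<lambda>n. star (f n)) \<longlonglongrightarrow> star l"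
    using bounded_linear.tendsto[OF bounded_linear_star l] .
  moreover have "star (f n) = f n" for n using f by (simp add: cstar_positive_star)
  ultimately have "star l = l" using l by (simp add: LIMSEQ_unique)
  moreover have "norm (t *\<^sub>R 1 - l) \<le> t"
  proof (rule LIMSEQ_le_const2)
    show "(\<lambda>n. norm (t *\<^sub>R 1 - f n)) \<longlonglongrightarrow> norm (t *\<^sub>R 1 - l)" using l by (intro tendsto_intros)
    show "\<exists>N. \<forall>n\<ge>N. norm (t *\<^sub>R 1 - f n) \<le> t" using cstar_positive_norm t f by blast
  qed
  ultimately show "l \<in> {a. cstar_positive a}" using cstar_positiveI by blast
qed

text \<open>
  \<open>a \<le> b \<le> \<parallel>b\<parallel>\<close> confines the spectrum of \<open>a\<close> to \<open>[0, \<parallel>b\<parallel>]\<close>.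
\<close>

lemma cstar_positive_norm_mono:
  fixes a b :: "'a::cstar_algebra"
  assumes a: "cstar_positive a" and ab: "cstar_positive (b - a)"
  shows "norm a \<le> norm b"
proof (rule norm_le_if_spectrum_le)
  show "star a = a" using a by (rule cstar_positive_star)
  have "cstar_positive (a + (b - a))" using a ab by (rule cstar_positive_add)
  then have "cstar_positive (norm b *\<^sub>R 1 - b)"
    by (intro cstar_positive_norm_minus) (auto simp: cstar_positive_star)
  then have p: "cstar_positive (norm b *\<^sub>R 1 - a)" using cstar_positive_add[OF _ ab] by fastforce
  fix z assume z: "z \<in> cstar_spectrum a"
  then have "of_real (norm b) - z \<in> cstar_spectrum (norm b *\<^sub>R 1 - a)" by (simp add: spectrum_shift)
  then obtain s where s: "s \<ge> 0" "of_real (norm b) - z = of_real s"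
    using cstar_positive_spectrum[OF p] by metis
  obtain r where r: "r \<ge> 0" "z = of_real r" using cstar_positive_spectrum[OF a z] by metis
  have "complex_of_real (norm b - r) = complex_of_real s" using s r by simp
  then have "norm b - r = s" by (simp only: of_real_eq_iff)
  then show "cmod z \<le> norm b" using r s by simp
qed

text \<open>
  For \<open>s > 0\<close> the element \<open>c\<^sup>2 + s\<^sup>2 = (c + \<i>s) (c - \<i>s)\<close> is invertible, since \<open>c\<close> has real spectrum.
\<close>

lemma cstar_positive_square:
  fixes c :: "'a::cstar_algebra"
  assumes c: "star c = c"
  shows "cstar_positive (c * c)"
  unfolding cstar_positive_def
proof (intro conjI subsetI)
  show sc: "star (c * c) = c * c" using c by (simp add: star_mult)
  fix z assume z: "z \<in> cstar_spectrum (c * c)"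
  then have im: "Im z = 0" using spectrum_real sc by blast
  have "Re z \<ge> 0"
  proof (rule ccontr)
    assume neg: "\<not> ?thesis"
    define s where "s = sqrt (- Re z)"
    have s: "s > 0" "s * s = - Re z" using neg by (simp_all add: s_def)
    then have zs: "z = - of_real (s * s)" using im by (simp add: complex_eq_iff)
    have u: "invertible_element (scaleC w 1 - c)" if "Im w \<noteq> 0" for w
      using spectrum_real[OF c, of w] that by (auto simp: cstar_spectrum_iff)
    have "invertible_element ((scaleC (\<i> * of_real s) 1 - c) * (scaleC (- \<i> * of_real s) 1 - c))"
      using s by (intro invertible_element_mult u) auto
    also have "(scaleC (\<i> * of_real s) 1 - c) * (scaleC (- \<i> * of_real s) 1 - c) = - (scaleC z 1 - c * c)"
      unfolding zs by (simp add: algebra_simps scaleC_mult_left scaleC_mult_right scaleC_scaleC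
        scaleC_minus_left scaleC_diff_right)
    finally show False using z unfolding cstar_spectrum_iff invertible_element_minus by blast
  qed
  moreover have "z = complex_of_real (Re z)" using im by (simp add: complex_eq_iff)
  ultimately show "z \<in> complex_of_real ` {0..}" by (metis atLeast_iff imageI)
qed

lemma invertible_element_positive_plus:
  fixes a :: "'a::cstar_algebra"
  assumes "cstar_positive a" "\<delta> > 0"
  shows "invertible_element (a + \<delta> *\<^sub>R 1)"
proof (rule ccontr)
  assume "\<not> ?thesis"
  moreover have "scaleC (- of_real \<delta>) 1 - a = - (a + \<delta> *\<^sub>R 1)"
    by (simp add: scaleC_minus_left scaleC_of_real)
  ultimately have "- of_real \<delta> \<in> cstar_spectrum a" by (simp only: cstar_spectrum_iff invertible_element_minus not_False_eq_True)
  then obtain r where "r \<ge> 0" "- complex_of_real \<delta> = of_real r"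
    using cstar_positive_spectrum[OF assms(1)] by metis
  then show False using assms(2) by (simp add: complex_eq_iff)
qed

text \<open>
  With \<open>t = \<parallel>a\<parallel>\<close> and \<open>m = \<parallel>t - a\<parallel> \<le> t\<close>, one of \<open>t - m\<close>, \<open>t + m\<close> is in the spectrum of \<open>a\<close>. So
  \<open>m = t\<close> is impossible: \<open>0\<close> is not in the spectrum by invertibility, and \<open>2t\<close> exceeds the norm.
  Then \<open>\<delta> = t - m\<close> works, by the norm criterion for positivity.
\<close>

lemma positive_invertible_element_bounded_below:
  fixes a :: "'a::cstar_algebra"
  assumes a: "cstar_positive a" and u: "invertible_element a"
  obtains \<delta> where "\<delta> > 0" "cstar_positive (a - \<delta> *\<^sub>R 1)"
proof -
  define t m where "t = norm a" and "m = norm (t *\<^sub>R 1 - a)"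
  have sa: "star a = a" using a by (rule cstar_positive_star)
  have t: "t > 0" using u unfolding t_def invertible_element_def by auto
  have "m \<le> t" unfolding m_def t_def using cstar_positive_norm[OF a order_refl] .
  moreover have "m \<noteq> t"
  proof
    assume mt: "m = t"
    have "star (t *\<^sub>R 1 - a) = t *\<^sub>R 1 - a" using sa by (simp add: star_diff star_scaleR)
    from norm_in_spectrum[OF this]
    have "of_real t - of_real m \<in> cstar_spectrum a \<or> of_real t + of_real m \<in> cstar_spectrum a"
      by (simp add: spectrum_shift m_def)
    then have "0 \<in> cstar_spectrum a \<or> of_real (2 * t) \<in> cstar_spectrum a" by (simp add: mt)
    moreover have "0 \<notin> cstar_spectrum a" using u by (simp add: cstar_spectrum_iff invertible_element_minus)
    moreover have "of_real (2 * t) \<notin> cstar_spectrum a"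
      using cmod_spectrum_le[of "of_real (2 * t)" a] t unfolding norm_of_real by (auto simp: t_def)
    ultimately show False by blast
  qed
  ultimately have d: "t - m > 0" by simp
  have "cstar_positive (a - (t - m) *\<^sub>R 1)"
  proof (rule cstar_positiveI)
    show "star (a - (t - m) *\<^sub>R 1) = a - (t - m) *\<^sub>R 1" using sa by (simp add: star_diff star_scaleR)
    have "m *\<^sub>R 1 - (a - (t - m) *\<^sub>R 1) = t *\<^sub>R 1 - a" by (simp add: algebra_simps)
    then show "norm (m *\<^sub>R 1 - (a - (t - m) *\<^sub>R 1)) \<le> m" unfolding m_def by (simp only: order_refl)
  qed
  with d that show ?thesis by blast
qed


section \<open>Conjugation, inverse square roots and the order\<close>

lemma star_inverse:
  fixes c :: "'a::cstar_algebra"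
  assumes "star c = c" "c * e = 1"
  shows "e * c = 1 \<and> star e = e"
proof -
  have "star e * c = 1" using assms by (metis star_mult star_one)
  then have "star e = e" using assms(2) by (metis mult.assoc mult.left_neutral mult.right_neutral)
  then show ?thesis using \<open>star e * c = 1\<close> by simp
qed

text \<open>
  The general fact that \<open>c d c\<^sup>*\<close> is positive lies deeper; for an invertible self-adjoint \<open>c\<close> with
  inverse \<open>e\<close> it is enough to write \<open>c d c + l = c (d + l e\<^sup>2) c\<close> and to note that for \<open>l > 0\<close> the
  element \<open>d + l e\<^sup>2\<close> is bounded below by a positive number, hence invertible.
\<close>

lemma cstar_positive_conj:
  fixes c d :: "'a::cstar_algebra"
  assumes d: "cstar_positive d" and c: "star c = c" and ce: "c * e = 1"
  shows "cstar_positive (c * d * c)"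
  unfolding cstar_positive_def
proof (intro conjI subsetI)
  have ec: "e * c = 1" and e: "star e = e" using star_inverse[OF c ce] by auto
  have uc: "invertible_element c" and ue: "invertible_element e" using ec ce unfolding invertible_element_def by blast+
  show sc: "star (c * d * c) = c * d * c"
    using c cstar_positive_star[OF d] by (simp add: star_mult mult.assoc)
  fix z assume z: "z \<in> cstar_spectrum (c * d * c)"
  then have im: "Im z = 0" using spectrum_real sc by blast
  have "Re z \<ge> 0"
  proof (rule ccontr)
    assume "\<not> ?thesis"
    define l where "l = - Re z"
    have l: "l > 0" "z = - of_real l" using \<open>\<not> Re z \<ge> 0\<close> im by (simp_all add: l_def complex_eq_iff)
    obtain \<delta> where \<delta>: "\<delta> > 0" "cstar_positive (e * e - \<delta> *\<^sub>R 1)"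
      using positive_invertible_element_bounded_below[OF cstar_positive_square[OF e] invertible_element_mult[OF ue ue]] .
    have "invertible_element ((d + l *\<^sub>R (e * e - \<delta> *\<^sub>R 1)) + (l * \<delta>) *\<^sub>R 1)"
      using l \<delta> d by (intro invertible_element_positive_plus cstar_positive_add cstar_positive_scaleR) auto
    also have "(d + l *\<^sub>R (e * e - \<delta> *\<^sub>R 1)) + (l * \<delta>) *\<^sub>R 1 = d + l *\<^sub>R (e * e)"
      by (simp add: algebra_simps)
    finally have "invertible_element (c * (d + l *\<^sub>R (e * e)) * c)" using uc by (intro invertible_element_mult)
    also have "c * (d + l *\<^sub>R (e * e)) * c = c * d * c + l *\<^sub>R ((c * e) * (e * c))"
      by (simp add: algebra_simps)
    also have "\<dots> = - (scaleC z 1 - c * d * c)"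
      unfolding l(2) ec ce by (simp add: scaleC_minus_left scaleC_of_real)
    finally show False using z unfolding cstar_spectrum_iff invertible_element_minus by blast
  qed
  moreover have "z = complex_of_real (Re z)" using im by (simp add: complex_eq_iff)
  ultimately show "z \<in> complex_of_real ` {0..}" by (metis atLeast_iff imageI)
qed

text \<open>
  The binomial series \<open>(1 - z)^(-1/2) = \<Sum> g\<^sub>n z\<^sup>n\<close> has coefficients in \<open>[0, 1]\<close>, so it converges
  absolutely for \<open>\<parallel>z\<parallel> < 1\<close>. By Vandermonde's convolution its Cauchy square is the geometric series.
\<close>

lemma inverse_sqrt_one_minus:
  fixes z :: "'a::cstar_algebra"
  assumes z: "star z = z" "norm z < 1"
  obtains c where "star c = c" "c * z = z * c" "c * c * (1 - z) = 1"
proof -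
  define g :: "nat \<Rightarrow> real" where "g n = pochhammer (1/2) n / fact n" for n
  have g0: "0 \<le> g n" for n unfolding g_def by (simp add: pochhammer_nonneg)
  have g1: "g n \<le> 1" for n
  proof -
    have "pochhammer (1/2) n \<le> (fact n :: real)"
      by (induction n) (auto simp: pochhammer_rec' mult.commute intro!: mult_mono pochhammer_nonneg)
    then show ?thesis by (simp add: g_def)
  qed
  have conv: "(\<Sum>k\<le>n. g k * g (n - k)) = 1" for n
  proof -
    have g: "g k = (-1) ^ k * ((-1/2) gchoose k)" for k
      unfolding g_def gbinomial_pochhammer by simp
    have "(\<Sum>k\<le>n. g k * g (n - k)) = (-1) ^ n * (\<Sum>k\<le>n. ((-1/2) gchoose k) * ((-1/2) gchoose (n - k)))"
      unfolding sum_distrib_left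
    proof (intro sum.cong refl)
      fix k assume "k \<in> {..n}"
      then have "(-1::real) ^ n = (-1) ^ k * (-1) ^ (n - k)" by (simp flip: power_add)
      then show "g k * g (n - k) = (-1) ^ n * (((-1/2) gchoose k) * ((-1/2) gchoose (n - k)))"
        by (simp add: g)
    qed
    also have "\<dots> = (-1) ^ n * ((-1 :: real) gchoose n)"
      using gbinomial_Vandermonde[of "-1/2 :: real" "-1/2" n] by (simp add: atMost_atLeast0)
    also have "\<dots> = 1"
      by (simp add: gbinomial_pochhammer pochhammer_fact[symmetric] flip: power_add mult_2)
    finally show ?thesis .
  qed
  define f where "f n = g n *\<^sub>R z ^ n" for n
  have nf: "norm (f n) \<le> norm z ^ n" for n
    using mult_mono[OF g1 norm_power_ineq[of z n]] g0[of n] by (simp add: f_def)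
  have sn: "summable (\<lambda>n. norm (f n))"
    by (rule summable_comparison_test'[where g="\<lambda>n. norm z ^ n" and N=0])
       (use z nf in \<open>auto intro: summable_geometric\<close>)
  then have sf: "summable f" by (rule summable_norm_cancel)
  define c where "c = suminf f"
  have "star c = (\<Sum>n. star (f n))"
    unfolding c_def by (rule bounded_linear.suminf[OF bounded_linear_star sf])
  then have 1: "star c = c"
    by (simp add: c_def f_def[abs_def] star_scaleR star_power z)
  have "c * z = (\<Sum>n. f n * z)" "z * c = (\<Sum>n. z * f n)"
    unfolding c_def using sf by (simp_all add: suminf_mult2 suminf_mult)
  then have 2: "c * z = z * c" by (simp add: f_def power_commutes)
  have "c * c = (\<Sum>k. \<Sum>i\<le>k. f i * f (k - i))"
    unfolding c_def by (rule Cauchy_product[OF sn sn])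
  also have "(\<lambda>k. \<Sum>i\<le>k. f i * f (k - i)) = (\<lambda>k. z ^ k)"
  proof
    fix k
    have "(\<Sum>i\<le>k. f i * f (k - i)) = (\<Sum>i\<le>k. (g i * g (k - i)) *\<^sub>R z ^ k)"
      by (intro sum.cong refl) (simp add: f_def flip: power_add)
    also have "\<dots> = z ^ k" by (simp only: conv scaleR_one flip: scaleR_sum_left)
    finally show "(\<Sum>i\<le>k. f i * f (k - i)) = z ^ k" .
  qed
  finally have cc: "c * c = (\<Sum>k. z ^ k)" .
  have 3: "c * c * (1 - z) = 1"
    unfolding cc by (rule geometric_suminf_mult[OF z(2)])
  show ?thesis using that 1 2 3 by blast
qed

text \<open>
  Here \<open>c = (p + \<epsilon>)^(-1/2)\<close> and \<open>e = (p + \<epsilon>)^(1/2)\<close>. With \<open>N = \<parallel>p\<parallel> + \<epsilon>\<close> one has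
  \<open>p + \<epsilon> = N (1 - z)\<close> for \<open>z = (\<parallel>p\<parallel> - p) / N\<close>, and positivity of \<open>p\<close> yields \<open>\<parallel>z\<parallel> < 1\<close>.
\<close>

lemma inverse_sqrt:
  fixes p :: "'a::cstar_algebra"
  assumes p: "cstar_positive p" and \<epsilon>: "\<epsilon> > 0"
  obtains c e where "star c = c" "c * e = 1" "e * e = p + \<epsilon> *\<^sub>R 1"
proof -
  define N where "N = norm p + \<epsilon>"
  have N: "N > 0" using \<epsilon> by (simp add: N_def add_nonneg_pos)
  define z where "z = (1 / N) *\<^sub>R (norm p *\<^sub>R 1 - p)"
  have z1: "star z = z" using cstar_positive_star[OF p] by (simp add: z_def star_scaleR star_diff)
  have "norm z \<le> norm p / N"
    using cstar_positive_norm[OF p order_refl] N by (simp add: z_def divide_right_mono)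
  also have "\<dots> < 1" using N \<epsilon> by (simp add: N_def)
  finally obtain b where b: "star b = b" "b * z = z * b" "b * b * (1 - z) = 1"
    using inverse_sqrt_one_minus[OF z1] by blast
  have "N *\<^sub>R z = norm p *\<^sub>R 1 - p" using N by (simp add: z_def)
  then have r: "p + \<epsilon> *\<^sub>R 1 = N *\<^sub>R (1 - z)" by (simp add: scaleR_diff_right N_def algebra_simps)
  define c where "c = (1 / sqrt N) *\<^sub>R b"
  define e where "e = sqrt N *\<^sub>R (b * (1 - z))"
  have c: "star c = c" using b by (simp add: c_def star_scaleR)
  have ce: "c * e = 1" using N b(3) by (simp add: c_def e_def mult.assoc)
  have bz: "b * (1 - z) = (1 - z) * b" using b(2) by (simp add: algebra_simps)
  have "e * e = N *\<^sub>R ((b * (1 - z)) * (b * (1 - z)))" using N by (simp add: e_def)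
  also have "(b * (1 - z)) * (b * (1 - z)) = (1 - z) * (b * b * (1 - z))" by (metis bz mult.assoc)
  finally have "e * e = p + \<epsilon> *\<^sub>R 1" using b(3) r by simp
  with c ce that show ?thesis by blast
qed

text \<open>
  Conjugation by \<open>c = (p + \<epsilon>)^(-1/2)\<close> reduces the comparison of \<open>q\<close> with \<open>p + \<epsilon>\<close> to the comparison of
  \<open>c q c\<close> with the unit, and a positive element is at most the unit exactly if its norm is at most
  one. Then \<open>\<epsilon>\<close> tends to zero.
\<close>

theorem cstar_le_if_conj_norm_le:
  fixes p q :: "'a::cstar_algebra"
  assumes p: "cstar_positive p" and q: "cstar_positive q"
    and le: "\<And>c. star c = c \<Longrightarrow> norm (c * q * c) \<le> norm (c * p * c)"
  shows "q \<sqsubseteq>\<^sub>C p"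
proof -
  have *: "cstar_positive (p + \<epsilon> *\<^sub>R 1 - q)" if \<epsilon>: "\<epsilon> > 0" for \<epsilon>
  proof -
    obtain c e where c: "star c = c" "c * e = 1" and ee: "e * e = p + \<epsilon> *\<^sub>R 1"
      using inverse_sqrt[OF p \<epsilon>] .
    have ec: "e * c = 1" and e: "star e = e" using star_inverse[OF c] by auto
    \<comment> \<open>\<open>c p c = 1 - \<epsilon> c\<^sup>2\<close>, which is at most the unit because squares are positive.\<close>
    have "1 = (c * e) * (e * c)" by (simp add: c ec)
    also have "\<dots> = c * (e * e) * c" by (simp add: mult.assoc)
    also have "\<dots> = c * p * c + \<epsilon> *\<^sub>R (c * c)" unfolding ee by (simp add: algebra_simps)
    finally have "1 - c * p * c = \<epsilon> *\<^sub>R (c * c)" by (metis add_diff_cancel_left')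
    then have "cstar_positive (1 - c * p * c)"
      using cstar_positive_scaleR[OF cstar_positive_square[OF c(1)], of \<epsilon>] \<epsilon> by simp
    then have "norm (c * p * c) \<le> 1"
      using cstar_positive_norm_mono[OF cstar_positive_conj[OF p c]] by fastforce
    with le[OF c(1)] have "norm (c * q * c) \<le> 1" by linarith
    then have "cstar_positive (1 *\<^sub>R 1 - c * q * c)"
      using c cstar_positive_star[OF q]
      by (intro cstar_positive_norm_minus) (auto simp: star_mult mult.assoc)
    then have "cstar_positive (e * (1 *\<^sub>R 1 - c * q * c) * e)"
      by (rule cstar_positive_conj[OF _ e ec])
    also have "e * (1 *\<^sub>R 1 - c * q * c) * e = e * e - (e * c) * q * (c * e)"
      by (simp add: algebra_simps)
    finally show ?thesis by (simp add: ec c ee)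
  qed
  have "(\<lambda>n. p + (1 / real (Suc n)) *\<^sub>R 1 - q) \<longlonglongrightarrow> p + 0 *\<^sub>R 1 - q"
    by (intro tendsto_intros LIMSEQ_Suc lim_1_over_n)
  then have "p + 0 *\<^sub>R 1 - q \<in> {a. cstar_positive a}"
    by (rule closed_sequentially[OF closed_cstar_positive, rotated]) (simp add: *)
  then show ?thesis by (simp add: cstar_le_def)
qed


section \<open>Strong measurability\<close>

lemma strongly_measurable_cong_AE:
  assumes "AE w in M. f w = g w" "strongly_measurable M f"
  shows "strongly_measurable M g"
proof -
  obtain s where s: "\<And>i. simple_function M (s i)" "AE w in M. (\<lambda>i. s i w) \<longlonglongrightarrow> f w"
    using assms(2) unfolding strongly_measurable_def by blast
  have "AE w in M. (\<lambda>i. s i w) \<longlonglongrightarrow> g w" using s(2) assms(1) by eventually_elim simp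
  then show ?thesis using s(1) unfolding strongly_measurable_def by blast
qed

lemma strongly_measurable_simple: "simple_function M s \<Longrightarrow> strongly_measurable M s"
  unfolding strongly_measurable_def by (intro exI[of _ "\<lambda>i. s"]) auto

lemma strongly_measurable_compose2:
  assumes f: "strongly_measurable M f" and g: "strongly_measurable M g"
    and h: "\<And>X Y x y. X \<longlonglongrightarrow> x \<Longrightarrow> Y \<longlonglongrightarrow> y \<Longrightarrow> (\<lambda>i::nat. h (X i) (Y i)) \<longlonglongrightarrow> h x y"
  shows "strongly_measurable M (\<lambda>w. h (f w) (g w))"
proof -
  obtain s where s: "\<And>i. simple_function M (s i)" "AE w in M. (\<lambda>i. s i w) \<longlonglongrightarrow> f w"
    using f unfolding strongly_measurable_def by blast
  obtain t where t: "\<And>i. simple_function M (t i)" "AE w in M. (\<lambda>i. t i w) \<longlonglongrightarrow> g w"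
    using g unfolding strongly_measurable_def by blast
  have "AE w in M. (\<lambda>i. h (s i w) (t i w)) \<longlonglongrightarrow> h (f w) (g w)"
    using s(2) t(2) by eventually_elim (rule h)
  moreover have "simple_function M (\<lambda>w. h (s i w) (t i w))" for i
    using s(1) t(1) by (rule simple_function_compose2)
  ultimately show ?thesis
    unfolding strongly_measurable_def by (intro exI[of _ "\<lambda>i w. h (s i w) (t i w)"]) auto
qed

lemma strongly_measurable_diff:
  "strongly_measurable M f \<Longrightarrow> strongly_measurable M g \<Longrightarrow> strongly_measurable M (\<lambda>w. f w - g w)"
  by (erule strongly_measurable_compose2) (auto intro: tendsto_diff)

lemma strongly_measurable_add:
  "strongly_measurable M f \<Longrightarrow> strongly_measurable M g \<Longrightarrow> strongly_measurable M (\<lambda>w. f w + g w)"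
  by (erule strongly_measurable_compose2) (auto intro: tendsto_add)

lemma strongly_measurable_bounded_linear:
  assumes "bounded_linear h" "strongly_measurable M f"
  shows "strongly_measurable M (\<lambda>w. h (f w))"
  by (rule strongly_measurable_compose2[OF assms(2,2)]) (rule bounded_linear.tendsto[OF assms(1)])

text \<open>
  An almost everywhere limit of simple functions need not be Borel measurable when null sets have
  non-measurable subsets. Setting the approximants to zero on a measurable null set gives an
  everywhere convergent sequence and a Borel measurable limit.
\<close>

lemma strongly_measurable_representative:
  assumes "strongly_measurable M f"
  obtains g s where "AE w in M. f w = g w" "\<forall>i. simple_function M (s i)"
    "\<forall>w. (\<lambda>i. s i w) \<longlonglongrightarrow> g w" "g \<in> borel_measurable M"
proof -
  obtain s where s: "\<And>i. simple_function M (s i)" "AE w in M. (\<lambda>i. s i w) \<longlonglongrightarrow> f w"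
    using assms unfolding strongly_measurable_def by blast
  obtain N where N: "N \<in> null_sets M" "{w \<in> space M. \<not> (\<lambda>i. s i w) \<longlonglongrightarrow> f w} \<subseteq> N"
    using s(2) unfolding eventually_ae_filter by blast
  define g where "g w = (if w \<in> space M - N then f w else 0)" for w
  define t where "t i w = (if w \<in> space M - N then s i w else 0)" for i w
  have t: "simple_function M (t i)" for i
  proof -
    have "simple_function M (\<lambda>w. if w \<in> N then 0 else s i w)"
      using N(1) s(1) by (intro simple_function_If_set) (auto intro: simple_function_const)
    then show ?thesis by (rule iffD1[OF simple_function_cong, rotated]) (auto simp: t_def)
  qed
  have lim: "(\<lambda>i. t i w) \<longlonglongrightarrow> g w" for w using N(2) by (auto simp: t_def g_def)
  show ?thesis
  proof (rule that[where s=t])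
    show "AE w in M. f w = g w"
      using AE_not_in[OF N(1)] AE_space by eventually_elim (simp add: g_def)
    show "g \<in> borel_measurable M"
      by (rule borel_measurable_LIMSEQ_metric[of t])
         (auto intro: borel_measurable_simple_function t lim)
  qed (simp_all add: t lim)
qed

text \<open>
  The norm of a strongly measurable function may fail to be measurable, but additivity of the
  nonnegative integral holds for measurable integrands; one computes with \<open>u\<close> instead.
\<close>

lemma strongly_measurable_norm:
  assumes "strongly_measurable M f"
  obtains u where "u \<in> borel_measurable M" "AE w in M. ennreal (norm (f w)) = u w"
proof -
  obtain g s where g: "AE w in M. f w = g w" and "\<forall>i. simple_function M (s i)"
    "\<forall>w. (\<lambda>i. s i w) \<longlonglongrightarrow> g w" and g2: "g \<in> borel_measurable M"
    using strongly_measurable_representative[OF assms] .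
  have "(\<lambda>w. ennreal (norm (g w))) \<in> borel_measurable M" using g2 by simp
  moreover have "AE w in M. ennreal (norm (f w)) = ennreal (norm (g w))" using g by eventually_elim simp
  ultimately show ?thesis by (rule that)
qed

lemma nn_integral_norm_triangle:
  assumes f: "strongly_measurable M f" and g: "strongly_measurable M g"
    and le: "\<And>w. norm (h w) \<le> norm (f w) + norm (g w)"
  shows "(\<integral>\<^sup>+w. norm (h w) \<partial>M) \<le> (\<integral>\<^sup>+w. norm (f w) \<partial>M) + (\<integral>\<^sup>+w. norm (g w) \<partial>M)"
proof -
  obtain u where u[measurable]: "u \<in> borel_measurable M" and uf: "AE w in M. ennreal (norm (f w)) = u w"
    using strongly_measurable_norm[OF f] .
  obtain v where v[measurable]: "v \<in> borel_measurable M" and vg: "AE w in M. ennreal (norm (g w)) = v w"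
    using strongly_measurable_norm[OF g] .
  have "AE w in M. ennreal (norm (h w)) \<le> u w + v w"
    using uf vg
  proof eventually_elim
    case (elim w)
    have "ennreal (norm (h w)) \<le> ennreal (norm (f w)) + ennreal (norm (g w))"
      using le[of w] by (simp flip: ennreal_plus)
    then show ?case by (simp only: elim)
  qed
  then have "(\<integral>\<^sup>+w. norm (h w) \<partial>M) \<le> (\<integral>\<^sup>+w. u w + v w \<partial>M)" by (rule nn_integral_mono_AE)
  also have "\<dots> = (\<integral>\<^sup>+w. u w \<partial>M) + (\<integral>\<^sup>+w. v w \<partial>M)" by (rule nn_integral_add) auto
  also have "(\<integral>\<^sup>+w. u w \<partial>M) = (\<integral>\<^sup>+w. norm (f w) \<partial>M)" using uf by (intro nn_integral_cong_AE) auto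
  also have "(\<integral>\<^sup>+w. v w \<partial>M) = (\<integral>\<^sup>+w. norm (g w) \<partial>M)" using vg by (intro nn_integral_cong_AE) auto
  finally show ?thesis .
qed

lemma nn_integral_norm_cmult:
  assumes f: "strongly_measurable M f" and le: "\<And>w. norm (h w) \<le> K * norm (f w)" and K: "0 \<le> K"
  shows "(\<integral>\<^sup>+w. norm (h w) \<partial>M) \<le> ennreal K * (\<integral>\<^sup>+w. norm (f w) \<partial>M)"
proof -
  obtain u where u[measurable]: "u \<in> borel_measurable M" and uf: "AE w in M. ennreal (norm (f w)) = u w"
    using strongly_measurable_norm[OF f] .
  have "AE w in M. ennreal (norm (h w)) \<le> ennreal K * u w"
    using uf
  proof eventually_elim
    case (elim w)
    have "ennreal (norm (h w)) \<le> ennreal K * ennreal (norm (f w))"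
      using le[of w] K by (simp add: ennreal_leI flip: ennreal_mult)
    then show ?case by (simp only: elim)
  qed
  then have "(\<integral>\<^sup>+w. norm (h w) \<partial>M) \<le> (\<integral>\<^sup>+w. ennreal K * u w \<partial>M)" by (rule nn_integral_mono_AE)
  also have "\<dots> = ennreal K * (\<integral>\<^sup>+w. u w \<partial>M)" by (rule nn_integral_cmult) auto
  also have "(\<integral>\<^sup>+w. u w \<partial>M) = (\<integral>\<^sup>+w. norm (f w) \<partial>M)" using uf by (intro nn_integral_cong_AE) auto
  finally show ?thesis .
qed


section \<open>The Bochner integral in a Banach space\<close>

abbreviation sb_integrable where "sb_integrable \<equiv> Bochner_Integration.simple_bochner_integrable"
abbreviation sb_integral where "sb_integral \<equiv> Bochner_Integration.simple_bochner_integral"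

lemma sb_integrable_simple: "sb_integrable M s \<Longrightarrow> simple_function M s"
  by (erule Bochner_Integration.simple_bochner_integrable.cases)

lemma sb_integrable_strongly_measurable: "sb_integrable M s \<Longrightarrow> strongly_measurable M s"
  by (intro strongly_measurable_simple sb_integrable_simple)

text \<open>
  Simple functions close to the same \<open>f\<close> in the \<open>L\<^sup>1\<close> sense have close integrals. Uniqueness of the
  integral, its existence (by completeness), and stability under changing the approximating sequence
  all come from this estimate.
\<close>

lemma norm_sb_integral_diff_le:
  fixes f :: "'w \<Rightarrow> 'b::banach"
  assumes f: "strongly_measurable M f" and s: "sb_integrable M s" and t: "sb_integrable M t"
  shows "ennreal (norm (sb_integral M s - sb_integral M t)) \<le>
    (\<integral>\<^sup>+w. norm (f w - s w) \<partial>M) + (\<integral>\<^sup>+w. norm (f w - t w) \<partial>M)"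
proof -
  have "ennreal (norm (sb_integral M s - sb_integral M t)) = norm (sb_integral M (\<lambda>x. s x - t x))"
    using s t by (subst simple_bochner_integral_diff) auto
  also have "\<dots> \<le> sb_integral M (\<lambda>x. norm (s x - t x))"
    using simple_bochner_integrable_compose2[of "(-)" M "s" "t"] s t
    by (auto intro!: simple_bochner_integral_norm_bound)
  also have "\<dots> = (\<integral>\<^sup>+x. norm (s x - t x) \<partial>M)"
    using simple_bochner_integrable_compose2[of "\<lambda>x y. norm (x - y)" M "s" "t"] s t
    by (auto intro!: simple_bochner_integral_eq_nn_integral)
  also have "\<dots> \<le> (\<integral>\<^sup>+w. norm (f w - s w) \<partial>M) + (\<integral>\<^sup>+w. norm (f w - t w) \<partial>M)"
  proof (rule nn_integral_norm_triangle)
    fix w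
    have "s w - t w = (f w - t w) - (f w - s w)" by simp
    then show "norm (s w - t w) \<le> norm (f w - s w) + norm (f w - t w)"
      by (metis norm_triangle_ineq4 add.commute)
  qed (use f s t sb_integrable_strongly_measurable strongly_measurable_diff in blast)+
  finally show ?thesis .
qed

lemma has_bochnerE:
  assumes "has_bochner M f I"
  obtains s where "strongly_measurable M f" "\<forall>i. sb_integrable M (s i)"
    "(\<lambda>i. \<integral>\<^sup>+w. norm (f w - s i w) \<partial>M) \<longlonglongrightarrow> 0" "(\<lambda>i. sb_integral M (s i)) \<longlonglongrightarrow> I"
  using assms unfolding has_bochner_def by blast

lemma has_bochner_unique:
  assumes "has_bochner M f I" "has_bochner M f J"
  shows "I = J"
proof -
  obtain s where f: "strongly_measurable M f" and s_sbi: "\<forall>i. sb_integrable M (s i)" and s_lim: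
    "(\<lambda>i. \<integral>\<^sup>+w. norm (f w - s i w) \<partial>M) \<longlonglongrightarrow> 0" "(\<lambda>i. sb_integral M (s i)) \<longlonglongrightarrow> I"
    using has_bochnerE[OF assms(1)] .
  note s = s_sbi[rule_format] s_lim
  obtain t where "strongly_measurable M f" and t_sbi: "\<forall>i. sb_integrable M (t i)" and t_lim:
    "(\<lambda>i. \<integral>\<^sup>+w. norm (f w - t i w) \<partial>M) \<longlonglongrightarrow> 0" "(\<lambda>i. sb_integral M (t i)) \<longlonglongrightarrow> J"
    using has_bochnerE[OF assms(2)] .
  note t = t_sbi[rule_format] t_lim
  have "(\<lambda>i. ennreal (norm (sb_integral M (s i) - sb_integral M (t i)))) \<longlonglongrightarrow> ennreal 0"
  proof (rule tendsto_sandwich[where f="\<lambda>_. 0"])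
    show "eventually (\<lambda>i. ennreal (norm (sb_integral M (s i) - sb_integral M (t i))) \<le>
      (\<integral>\<^sup>+w. norm (f w - s i w) \<partial>M) + (\<integral>\<^sup>+w. norm (f w - t i w) \<partial>M)) sequentially"
      by (intro always_eventually allI norm_sb_integral_diff_le f s t)
    show "(\<lambda>i. (\<integral>\<^sup>+w. norm (f w - s i w) \<partial>M) + (\<integral>\<^sup>+w. norm (f w - t i w) \<partial>M)) \<longlonglongrightarrow> ennreal 0"
      using tendsto_add[OF s(2) t(2)] by simp
  qed simp_all
  then have "(\<lambda>i. norm (sb_integral M (s i) - sb_integral M (t i))) \<longlonglongrightarrow> 0"
    by (subst (asm) tendsto_ennreal_iff) auto
  moreover have "(\<lambda>i. norm (sb_integral M (s i) - sb_integral M (t i))) \<longlonglongrightarrow> norm (I - J)"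
    using s(3) t(3) by (intro tendsto_intros)
  ultimately have "norm (I - J) = 0" using LIMSEQ_unique by blast
  then show ?thesis by simp
qed

lemma bochner_eqI: "has_bochner M f I \<Longrightarrow> bochner M f = I"
  unfolding bochner_def using has_bochner_unique by blast

lemma has_bochner_bochner: "bochner_integrable M f \<Longrightarrow> has_bochner M f (bochner M f)"
  unfolding bochner_integrable_def using bochner_eqI by metis

lemma has_bochner_cong_AE:
  assumes "AE w in M. f w = g w" "has_bochner M f I"
  shows "has_bochner M g I"
proof -
  obtain s where f: "strongly_measurable M f" and s_sbi: "\<forall>i. sb_integrable M (s i)" and s_lim:
    "(\<lambda>i. \<integral>\<^sup>+w. norm (f w - s i w) \<partial>M) \<longlonglongrightarrow> 0" "(\<lambda>i. sb_integral M (s i)) \<longlonglongrightarrow> I"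
    using has_bochnerE[OF assms(2)] .
  note s = s_sbi[rule_format] s_lim
  have "(\<integral>\<^sup>+w. norm (f w - s i w) \<partial>M) = (\<integral>\<^sup>+w. norm (g w - s i w) \<partial>M)" for i
    by (rule nn_integral_cong_AE) (use assms(1) in eventually_elim, simp)
  with s strongly_measurable_cong_AE[OF assms(1) f] show ?thesis
    unfolding has_bochner_def by auto
qed

lemma has_bochner_cong:
  assumes "\<And>w. w \<in> space M \<Longrightarrow> f w = g w" "has_bochner M f I"
  shows "has_bochner M g I"
  by (rule has_bochner_cong_AE[OF AE_I2 assms(2)]) (rule assms(1))

lemma has_bochner_add:
  assumes "has_bochner M f I" "has_bochner M g J"
  shows "has_bochner M (\<lambda>w. f w + g w) (I + J)"
proof -
  obtain s where f: "strongly_measurable M f" and s_sbi: "\<forall>i. sb_integrable M (s i)" and s_lim: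
    "(\<lambda>i. \<integral>\<^sup>+w. norm (f w - s i w) \<partial>M) \<longlonglongrightarrow> 0" "(\<lambda>i. sb_integral M (s i)) \<longlonglongrightarrow> I"
    using has_bochnerE[OF assms(1)] .
  note s = s_sbi[rule_format] s_lim
  obtain t where g: "strongly_measurable M g" and t_sbi: "\<forall>i. sb_integrable M (t i)" and t_lim:
    "(\<lambda>i. \<integral>\<^sup>+w. norm (g w - t i w) \<partial>M) \<longlonglongrightarrow> 0" "(\<lambda>i. sb_integral M (t i)) \<longlonglongrightarrow> J"
    using has_bochnerE[OF assms(2)] .
  note t = t_sbi[rule_format] t_lim
  have "(\<lambda>i. \<integral>\<^sup>+w. norm (f w + g w - (s i w + t i w)) \<partial>M) \<longlonglongrightarrow> 0"
  proof (rule tendsto_sandwich[where f="\<lambda>_. 0"])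
    show "eventually (\<lambda>i. (\<integral>\<^sup>+w. norm (f w + g w - (s i w + t i w)) \<partial>M) \<le>
      (\<integral>\<^sup>+w. norm (f w - s i w) \<partial>M) + (\<integral>\<^sup>+w. norm (g w - t i w) \<partial>M)) sequentially"
      by (intro always_eventually allI nn_integral_norm_triangle strongly_measurable_diff f g
          sb_integrable_strongly_measurable s t norm_diff_triangle_ineq)
    show "(\<lambda>i. (\<integral>\<^sup>+w. norm (f w - s i w) \<partial>M) + (\<integral>\<^sup>+w. norm (g w - t i w) \<partial>M)) \<longlonglongrightarrow> 0"
      using tendsto_add[OF s(2) t(2)] by simp
  qed simp_all
  moreover have "sb_integrable M (\<lambda>w. s i w + t i w)" for i using s t by (simp add: simple_bochner_integrable_compose2)
  moreover have "(\<lambda>i. sb_integral M (\<lambda>w. s i w + t i w)) \<longlonglongrightarrow> I + J"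
    using s t by (simp add: simple_bochner_integral_add tendsto_add)
  ultimately show ?thesis using strongly_measurable_add[OF f g]
    unfolding has_bochner_def by (intro conjI exI[of _ "\<lambda>i w. s i w + t i w"]) auto
qed

lemma has_bochner_bounded_linear:
  assumes h: "bounded_linear h" and "has_bochner M f I"
  shows "has_bochner M (\<lambda>w. h (f w)) (h I)"
proof -
  interpret h: bounded_linear h by (fact h)
  obtain s where f: "strongly_measurable M f" and s_sbi: "\<forall>i. sb_integrable M (s i)" and s_lim:
    "(\<lambda>i. \<integral>\<^sup>+w. norm (f w - s i w) \<partial>M) \<longlonglongrightarrow> 0" "(\<lambda>i. sb_integral M (s i)) \<longlonglongrightarrow> I"
    using has_bochnerE[OF assms(2)] .
  note s = s_sbi[rule_format] s_lim
  obtain K where K: "0 \<le> K" "\<And>x. norm (h x) \<le> norm x * K" using h.nonneg_bounded by blast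
  have "(\<lambda>i. \<integral>\<^sup>+w. norm (h (f w) - h (s i w)) \<partial>M) \<longlonglongrightarrow> 0"
  proof (rule tendsto_sandwich[where f="\<lambda>_. 0"])
    show "eventually (\<lambda>i. (\<integral>\<^sup>+w. norm (h (f w) - h (s i w)) \<partial>M) \<le>
      ennreal K * (\<integral>\<^sup>+w. norm (f w - s i w) \<partial>M)) sequentially"
      by (intro always_eventually allI nn_integral_norm_cmult strongly_measurable_diff f
          sb_integrable_strongly_measurable s K) (metis K(2) h.diff mult.commute)
    show "(\<lambda>i. ennreal K * (\<integral>\<^sup>+w. norm (f w - s i w) \<partial>M)) \<longlonglongrightarrow> 0"
      using ennreal_tendsto_cmult[OF _ s(2), of "ennreal K"] by simp
  qed simp_all
  moreover have "sb_integrable M (\<lambda>w. h (s i w))" for i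
    using simple_bochner_integrable_compose2[of "\<lambda>x y. h x", OF h.zero s(1) s(1)] .
  moreover have "(\<lambda>i. sb_integral M (\<lambda>w. h (s i w))) \<longlonglongrightarrow> h I"
    using s h.tendsto[OF s(3)] by (simp add: simple_bochner_integral_linear[OF h.linear])
  ultimately show ?thesis using strongly_measurable_bounded_linear[OF h f]
    unfolding has_bochner_def by (intro conjI exI[of _ "\<lambda>i w. h (s i w)"]) auto
qed

lemma nn_integral_norm_finite:
  assumes "bochner_integrable M f"
  shows "(\<integral>\<^sup>+w. norm (f w) \<partial>M) < \<infinity>"
proof -
  obtain I where I: "has_bochner M f I" using assms unfolding bochner_integrable_def by blast
  obtain s where f: "strongly_measurable M f" and s_sbi: "\<forall>i. sb_integrable M (s i)" and s_lim:
    "(\<lambda>i. \<integral>\<^sup>+w. norm (f w - s i w) \<partial>M) \<longlonglongrightarrow> 0" "(\<lambda>i. sb_integral M (s i)) \<longlonglongrightarrow> I"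
    using has_bochnerE[OF I] .
  note s = s_sbi[rule_format] s_lim
  have "eventually (\<lambda>i. (\<integral>\<^sup>+w. norm (f w - s i w) \<partial>M) < 1) sequentially"
    using order_tendstoD(2)[OF s(2), of 1] by simp
  then obtain i where i: "(\<integral>\<^sup>+w. norm (f w - s i w) \<partial>M) < 1" by (auto simp: eventually_sequentially)
  have "sb_integrable M (\<lambda>w. norm (s i w))"
    using simple_bochner_integrable_compose2[of "\<lambda>x y. norm x" M "s i" "s i"] s(1) by simp
  from simple_bochner_integral_eq_nn_integral[OF this]
  have "(\<integral>\<^sup>+w. norm (s i w) \<partial>M) < \<infinity>" by (metis ennreal_less_top infinity_ennreal_def norm_ge_zero)
  moreover have "(\<integral>\<^sup>+w. norm (f w) \<partial>M) \<le> (\<integral>\<^sup>+w. norm (f w - s i w) \<partial>M) + (\<integral>\<^sup>+w. norm (s i w) \<partial>M)"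
    by (intro nn_integral_norm_triangle strongly_measurable_diff f sb_integrable_strongly_measurable s)
       (metis norm_triangle_ineq diff_add_cancel)
  moreover have "(\<integral>\<^sup>+w. norm (f w - s i w) \<partial>M) < \<infinity>" using i by (rule order_less_trans) simp
  ultimately show ?thesis by (simp add: order_le_less_trans)
qed

text \<open>
  Bochner's criterion. Truncating the simple approximants \<open>s\<^sub>i\<close> of a Borel representative \<open>g\<close> to zero where
  \<open>\<parallel>s\<^sub>i\<parallel> > 2 \<parallel>g\<parallel>\<close> keeps pointwise convergence and provides the dominating function \<open>3 \<parallel>g\<parallel>\<close> for the
  errors.
\<close>

lemma bochner_integrable_bounded:
  fixes f :: "'w \<Rightarrow> 'b::banach"
  assumes f: "strongly_measurable M f" and fin: "(\<integral>\<^sup>+w. norm (f w) \<partial>M) < \<infinity>"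
  shows "bochner_integrable M f"
proof -
  obtain g s where fg: "AE w in M. f w = g w" and sf: "\<forall>i. simple_function M (s i)"
    "\<forall>w. (\<lambda>i. s i w) \<longlonglongrightarrow> g w" and g[measurable]: "g \<in> borel_measurable M"
    using strongly_measurable_representative[OF f] .
  note s = sf[rule_format]
  have "(\<integral>\<^sup>+w. norm (g w) \<partial>M) = (\<integral>\<^sup>+w. norm (f w) \<partial>M)"
    using fg by (intro nn_integral_cong_AE) auto
  with fin have fin: "(\<integral>\<^sup>+w. norm (g w) \<partial>M) < \<infinity>" by simp
  have sm: "strongly_measurable M g" using strongly_measurable_cong_AE[OF fg f] .
  define t where "t i w = (if norm (s i w) \<le> 2 * norm (g w) then s i w else 0)" for i w
  have [measurable]: "s i \<in> borel_measurable M" for i using s(1) by (rule borel_measurable_simple_function)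
  have t: "simple_function M (t i)" for i
    unfolding t_def using s(1) by (intro simple_function_If) (auto intro: simple_function_const)
  have tl: "(\<lambda>i. t i w) \<longlonglongrightarrow> g w" for w
  proof (cases "g w = 0")
    case True
    then have "t i w = 0" for i by (simp add: t_def)
    then show ?thesis using True by simp
  next
    case False
    then have "norm (g w) < 2 * norm (g w)" by simp
    then have "eventually (\<lambda>i. norm (s i w) < 2 * norm (g w)) sequentially"
      using order_tendstoD(2)[OF tendsto_norm[OF s(2)]] by blast
    then have "eventually (\<lambda>i. s i w = t i w) sequentially" by eventually_elim (simp add: t_def)
    then show ?thesis using s(2) by (rule Lim_transform_eventually[rotated])
  qed
  have tb: "norm (t i w) \<le> 2 * norm (g w)" for i w by (simp add: t_def)
  have sbi: "sb_integrable M (t i)" for i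
  proof (rule simple_bochner_integrableI_bounded[OF t])
    have "(\<integral>\<^sup>+w. norm (t i w) \<partial>M) \<le> ennreal 2 * (\<integral>\<^sup>+w. norm (g w) \<partial>M)"
      by (rule nn_integral_norm_cmult[OF sm tb]) simp
    also have "\<dots> < \<infinity>" using fin by (simp add: ennreal_mult_less_top)
    finally show "(\<integral>\<^sup>+w. norm (t i w) \<partial>M) < \<infinity>" .
  qed
  have "(\<lambda>i. \<integral>\<^sup>+w. norm (g w - t i w) \<partial>M) \<longlonglongrightarrow> (\<integral>\<^sup>+w. 0 \<partial>M)"
  proof (rule nn_integral_dominated_convergence)
    show "(\<lambda>w. ennreal (norm (g w - t i w))) \<in> borel_measurable M" for i
    proof -
      have "(\<lambda>w. g w - t i w) \<in> borel_measurable M"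
      proof (rule borel_measurable_LIMSEQ_metric)
        show "(\<lambda>w. t j w - t i w) \<in> borel_measurable M" for j
          by (rule borel_measurable_simple_function, rule simple_function_diff) (rule t)+
        show "(\<lambda>j. t j w - t i w) \<longlonglongrightarrow> g w - t i w" for w using tl by (intro tendsto_intros)
      qed
      then show ?thesis by simp
    qed
    show "AE w in M. ennreal (norm (g w - t i w)) \<le> ennreal (3 * norm (g w))" for i
    proof (intro AE_I2 ennreal_leI)
      fix w show "norm (g w - t i w) \<le> 3 * norm (g w)"
        using norm_triangle_ineq4[of "g w" "t i w"] tb[of i w] by linarith
    qed
    have "(\<integral>\<^sup>+w. ennreal (3 * norm (g w)) \<partial>M) = ennreal 3 * (\<integral>\<^sup>+w. norm (g w) \<partial>M)"
      by (subst nn_integral_cmult[symmetric]) (auto simp: ennreal_mult')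
    then show "(\<integral>\<^sup>+w. ennreal (3 * norm (g w)) \<partial>M) < \<infinity>" using fin by (simp add: ennreal_mult_less_top)
    show "AE w in M. (\<lambda>i. ennreal (norm (g w - t i w))) \<longlonglongrightarrow> 0"
    proof (rule AE_I2)
      fix w
      from tendsto_diff[OF tendsto_const[of "g w"] tl[of w]]
      show "(\<lambda>i. ennreal (norm (g w - t i w))) \<longlonglongrightarrow> 0"
        by (simp add: tendsto_norm_zero_iff flip: ennreal_0)
    qed
  qed auto
  then have lim: "(\<lambda>i. \<integral>\<^sup>+w. norm (g w - t i w) \<partial>M) \<longlonglongrightarrow> 0" by simp
  have "Cauchy (\<lambda>i. sb_integral M (t i))"
  proof (rule metric_CauchyI)
    fix e :: real assume e: "0 < e"
    have "eventually (\<lambda>i. (\<integral>\<^sup>+w. norm (g w - t i w) \<partial>M) < ennreal (e / 2)) sequentially"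
      using order_tendstoD(2)[OF lim, of "ennreal (e / 2)"] e by simp
    then obtain N where N: "\<And>i. i \<ge> N \<Longrightarrow> (\<integral>\<^sup>+w. norm (g w - t i w) \<partial>M) < ennreal (e / 2)"
      by (auto simp: eventually_sequentially)
    have "dist (sb_integral M (t i)) (sb_integral M (t j)) < e" if "i \<ge> N" "j \<ge> N" for i j
    proof -
      have "ennreal (norm (sb_integral M (t i) - sb_integral M (t j))) \<le>
          (\<integral>\<^sup>+w. norm (g w - t i w) \<partial>M) + (\<integral>\<^sup>+w. norm (g w - t j w) \<partial>M)"
        by (rule norm_sb_integral_diff_le[OF sm sbi sbi])
      also have "\<dots> < ennreal (e / 2) + ennreal (e / 2)" using N that by (intro add_strict_mono)
      also have "\<dots> = ennreal e" using e by (simp flip: ennreal_plus)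
      finally show ?thesis using e by (simp add: dist_norm ennreal_less_iff)
    qed
    then show "\<exists>N. \<forall>i\<ge>N. \<forall>j\<ge>N. dist (sb_integral M (t i)) (sb_integral M (t j)) < e" by blast
  qed
  then obtain I where "(\<lambda>i. sb_integral M (t i)) \<longlonglongrightarrow> I" using Cauchy_convergent_iff convergent_def by blast
  then have "has_bochner M g I" using sm sbi lim unfolding has_bochner_def by blast
  moreover have "AE w in M. g w = f w" using fg by eventually_elim simp
  ultimately show ?thesis unfolding bochner_integrable_def using has_bochner_cong_AE by blast
qed

text \<open>
  The simple approximants can be moved into the cone: replace each value \<open>y\<close> by a point of \<open>P\<close> which
  is at most twice as far from \<open>y\<close> as \<open>P\<close> itself. As \<open>f\<close> takes values in \<open>P\<close>, this at most triples the
  distance to \<open>f\<close>. Integrals of simple functions with values in \<open>P\<close> are finite sums in \<open>P\<close>, and \<open>P\<close>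
  is closed.
\<close>

lemma has_bochner_in_closed_cone:
  fixes f :: "'w \<Rightarrow> 'b::banach"
  assumes "has_bochner M f I" and fP: "\<And>w. w \<in> space M \<Longrightarrow> f w \<in> P"
    and P: "closed P" "0 \<in> P" "\<And>x y. x \<in> P \<Longrightarrow> y \<in> P \<Longrightarrow> x + y \<in> P"
      "\<And>r x. r \<ge> 0 \<Longrightarrow> x \<in> P \<Longrightarrow> r *\<^sub>R x \<in> P"
  shows "I \<in> P"
proof -
  obtain s where f: "strongly_measurable M f" and s_sbi: "\<forall>i. sb_integrable M (s i)" and s_lim:
    "(\<lambda>i. \<integral>\<^sup>+w. norm (f w - s i w) \<partial>M) \<longlonglongrightarrow> 0" "(\<lambda>i. sb_integral M (s i)) \<longlonglongrightarrow> I"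
    using has_bochnerE[OF assms(1)] .
  note s = s_sbi[rule_format] s_lim
  have "\<exists>p. p \<in> P \<and> (\<forall>z\<in>P. norm (y - p) \<le> 2 * norm (y - z)) \<and> (y = 0 \<longrightarrow> p = 0)" for y
  proof (cases "y \<in> P")
    case True
    then show ?thesis by (intro exI[of _ y]) auto
  next
    case False
    \<comment> \<open>The distance is positive as \<open>P\<close> is closed, so some point of \<open>P\<close> comes within twice the
      distance, although the distance itself may not be attained.\<close>
    have d: "infdist y P > 0"
      using False P(1,2) by (metis empty_iff in_closed_iff_infdist_zero infdist_nonneg less_eq_real_def)
    then have "(INF p\<in>P. dist y p) < 2 * infdist y P" using P(2) by (subst infdist_notempty[symmetric]) auto
    then obtain p where p: "p \<in> P" "dist y p < 2 * infdist y P"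
      using P(2) by (subst (asm) cINF_less_iff) auto
    moreover have "infdist y P \<le> norm (y - z)" if "z \<in> P" for z
      using infdist_le[OF that] by (simp add: dist_norm)
    ultimately show ?thesis using False P(2) by (intro exI[of _ p]) (fastforce simp: dist_norm)
  qed
  then obtain p where p: "\<And>y. p y \<in> P" "\<And>y z. z \<in> P \<Longrightarrow> norm (y - p y) \<le> 2 * norm (y - z)" "p 0 = 0"
    by metis
  have ps: "sb_integrable M (\<lambda>w. p (s i w))" for i
    using simple_bochner_integrable_compose2[of "\<lambda>x y. p x", OF p(3) s(1) s(1)] .
  have sumP: "sum h A \<in> P" if "\<And>x. x \<in> A \<Longrightarrow> h x \<in> P" for h and A :: "'b set"
    using that by (induction A rule: infinite_finite_induct) (auto simp: P)
  have psP: "sb_integral M (\<lambda>w. p (s i w)) \<in> P" for i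
    unfolding simple_bochner_integral_def by (rule sumP) (auto intro!: P(4) p(1))
  have "(\<lambda>i. \<integral>\<^sup>+w. norm (f w - p (s i w)) \<partial>M) \<longlonglongrightarrow> 0"
  proof (rule tendsto_sandwich[where f="\<lambda>_. 0"])
    have "(\<integral>\<^sup>+w. norm (f w - p (s i w)) \<partial>M) \<le> ennreal 3 * (\<integral>\<^sup>+w. norm (f w - s i w) \<partial>M)" for i
    proof -
      have "(\<integral>\<^sup>+w. norm (f w - p (s i w)) \<partial>M) = (\<integral>\<^sup>+w. norm (if w \<in> space M then f w - p (s i w) else 0) \<partial>M)"
        by (rule nn_integral_cong) simp
      also have "\<dots> \<le> ennreal 3 * (\<integral>\<^sup>+w. norm (f w - s i w) \<partial>M)"
      proof (rule nn_integral_norm_cmult)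
        fix w
        show "norm (if w \<in> space M then f w - p (s i w) else 0) \<le> 3 * norm (f w - s i w)"
          using p(2)[OF fP, of w "s i w"] norm_triangle_ineq[of "f w - s i w" "s i w - p (s i w)"]
          by (auto simp: norm_minus_commute)
      qed (auto intro: strongly_measurable_diff f sb_integrable_strongly_measurable s)
      finally show ?thesis .
    qed
    then show "eventually (\<lambda>i. (\<integral>\<^sup>+w. norm (f w - p (s i w)) \<partial>M) \<le>
      ennreal 3 * (\<integral>\<^sup>+w. norm (f w - s i w) \<partial>M)) sequentially" by simp
    show "(\<lambda>i. ennreal 3 * (\<integral>\<^sup>+w. norm (f w - s i w) \<partial>M)) \<longlonglongrightarrow> 0"
      using ennreal_tendsto_cmult[OF _ s(2), of "ennreal 3"] by simp
  qed simp_all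
  note lim_p = this
  have "(\<lambda>i. ennreal (norm (sb_integral M (\<lambda>w. p (s i w)) - sb_integral M (s i)))) \<longlonglongrightarrow> ennreal 0"
  proof (rule tendsto_sandwich[where f="\<lambda>_. 0"])
    show "eventually (\<lambda>i. ennreal (norm (sb_integral M (\<lambda>w. p (s i w)) - sb_integral M (s i))) \<le>
      (\<integral>\<^sup>+w. norm (f w - p (s i w)) \<partial>M) + (\<integral>\<^sup>+w. norm (f w - s i w) \<partial>M)) sequentially"
      by (intro always_eventually allI norm_sb_integral_diff_le f s ps)
    show "(\<lambda>i. (\<integral>\<^sup>+w. norm (f w - p (s i w)) \<partial>M) + (\<integral>\<^sup>+w. norm (f w - s i w) \<partial>M)) \<longlonglongrightarrow> ennreal 0"
      using tendsto_add[OF lim_p s(2)] by simp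
  qed simp_all
  then have "(\<lambda>i. norm (sb_integral M (\<lambda>w. p (s i w)) - sb_integral M (s i))) \<longlonglongrightarrow> 0"
    by (subst (asm) tendsto_ennreal_iff) auto
  then have "(\<lambda>i. sb_integral M (\<lambda>w. p (s i w)) - sb_integral M (s i)) \<longlonglongrightarrow> 0" by (rule tendsto_norm_zero_cancel)
  then have "(\<lambda>i. sb_integral M (\<lambda>w. p (s i w))) \<longlonglongrightarrow> I"
    by (rule Lim_transform[OF s(3)])
  then show ?thesis by (rule closed_sequentially[OF P(1) psP])
qed


section \<open>Hilbert modules and square-integrable families\<close>

context hilbert_module
begin

lemma ip_add_right: "ip x (y + z) = ip x y + ip x z"
  by (metis ip_add_left ip_star star_add)

lemma ip_act_right: "ip x (act a y) = ip x y * star a"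
  by (metis ip_act_left ip_star star_mult)

lemma ip_scaleR_left: "ip (r *\<^sub>R x) y = r *\<^sub>R ip x y"
  by (metis act_scaleR ip_act_left mult_scaleR_left mult.left_neutral)

lemma ip_scaleR_right: "ip x (r *\<^sub>R y) = r *\<^sub>R ip x y"
  by (metis ip_scaleR_left ip_star star_scaleR)

lemma ip_minus_left: "ip (- x) y = - ip x y"
  using ip_scaleR_left[of "-1"] by simp

lemma ip_minus_right: "ip x (- y) = - ip x y"
  using ip_scaleR_right[of x "-1"] by simp

lemma ip_diff_left: "ip (x - y) z = ip x z - ip y z"
  using ip_add_left[of x "- y"] by (simp add: ip_minus_left)

lemma ip_diff_right: "ip x (y - z) = ip x y - ip x z"
  using ip_add_right[of x y "- z"] by (simp add: ip_minus_right)

lemma norm_ip_self: "norm (ip x x) = (norm x)\<^sup>2"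
  by (simp add: norm_eq_sqrt_ip)

lemma eq_if_ip_eq: "(\<And>z. ip x z = ip y z) \<Longrightarrow> x = y"
  using ip_self_eq_0[of "x - y"] by (simp add: ip_diff_left)

text \<open>
  A weak Cauchy-Schwarz inequality, which follows from the triangle inequality of the norm by
  polarization: \<open>2 (\<langle>u, v\<rangle> + \<langle>v, u\<rangle>) = |u + v|\<^sup>2 - |u - v|\<^sup>2\<close>.
  It makes \<open>x \<mapsto> \<langle>x, x\<rangle>\<close> continuous, so that strong measurability passes to squares.
\<close>

lemma norm_symmetrized_ip_le: "norm (ip x y + ip y x) \<le> norm x * norm y * 4"
proof (cases "x = 0 \<or> y = 0")
  case True
  have "ip 0 z = 0" "ip z 0 = 0" for z using ip_scaleR_left[of 0] ip_scaleR_right[of _ 0] by simp_all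
  then show ?thesis using True by auto
next
  case False
  have unit: "norm (ip u v + ip v u) \<le> 4" if "norm u = 1" "norm v = 1" for u v
  proof -
    have "2 *\<^sub>R (ip u v + ip v u) = ip (u + v) (u + v) - ip (u - v) (u - v)"
      by (simp add: ip_add_left ip_add_right ip_diff_left ip_diff_right scaleR_2)
    then have "2 * norm (ip u v + ip v u) = norm (ip (u + v) (u + v) - ip (u - v) (u - v))"
      by (metis norm_scaleR abs_numeral)
    also have "\<dots> \<le> (norm (u + v))\<^sup>2 + (norm (u - v))\<^sup>2"
      by (metis norm_triangle_ineq4 norm_ip_self)
    also have "\<dots> \<le> 2\<^sup>2 + 2\<^sup>2"
      using norm_triangle_ineq[of u v] norm_triangle_ineq4[of u v] that
      by (intro add_mono power_mono) auto
    finally show ?thesis by simp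
  qed
  define u v where "u = (1 / norm x) *\<^sub>R x" and "v = (1 / norm y) *\<^sub>R y"
  have "norm u = 1" "norm v = 1" using False by (simp_all add: u_def v_def)
  then have *: "norm (ip u v + ip v u) \<le> 4" by (rule unit)
  have x: "x = norm x *\<^sub>R u" and y: "y = norm y *\<^sub>R v" using False by (simp_all add: u_def v_def)
  have "ip x y + ip y x = (norm x * norm y) *\<^sub>R (ip u v + ip v u)"
    by (subst x, subst (2) x, subst y, subst (2) y)
       (simp only: ip_scaleR_left ip_scaleR_right scaleR_scaleR scaleR_add_right mult.commute)
  then show ?thesis using * by (simp add: mult_left_mono)
qed

lemma tendsto_ip_self:
  assumes "X \<longlonglongrightarrow> x"
  shows "(\<lambda>i. ip (X i) (X i)) \<longlonglongrightarrow> ip x x"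
proof -
  interpret b: bounded_bilinear "\<lambda>x y. ip x y + ip y x"
  proof
    show "\<exists>K. \<forall>a b. norm (ip a b + ip b a) \<le> norm a * norm b * K"
      using norm_symmetrized_ip_le by blast
  qed (simp_all add: ip_add_left ip_add_right ip_scaleR_left ip_scaleR_right scaleR_add_right)
  have "(\<lambda>i. (1/2) *\<^sub>R (ip (X i) (X i) + ip (X i) (X i))) \<longlonglongrightarrow> (1/2) *\<^sub>R (ip x x + ip x x)"
    by (intro tendsto_scaleR tendsto_const b.tendsto assms)
  then show ?thesis by (simp flip: scaleR_2)
qed

lemma strongly_measurable_ip_self:
  assumes "strongly_measurable M u"
  shows "strongly_measurable M (\<lambda>w. ip (u w) (u w))"
  by (rule strongly_measurable_compose2[OF assms assms, of "\<lambda>x y. ip x x"]) (rule tendsto_ip_self)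

lemma adjointable_linear:
  assumes "adjointable ip F"
  shows "F (x + y) = F x + F y" "F (act a x) = act a (F x)"
proof -
  obtain S where S: "\<And>x y. ip (F x) y = ip x (S y)"
    using assms unfolding adjointable_def is_adjoint_def by blast
  show "F (x + y) = F x + F y" by (rule eq_if_ip_eq) (simp add: S ip_add_left)
  show "F (act a x) = act a (F x)" by (rule eq_if_ip_eq) (simp add: S ip_act_left)
qed

text \<open>
  Nondegeneracy of the inner product makes adjoints unique, so the definite description denotes the
  adjoint, whose own adjoint is \<open>F\<close>. So the adjoint is adjointable and therefore linear over the
  algebra.
\<close>

lemma adjointable_module_adjoint:
  assumes "adjointable ip F"
  shows "adjointable ip (module_adjoint ip F)"
proof -
  obtain S where S: "is_adjoint ip F S" using assms unfolding adjointable_def by blast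
  have "module_adjoint ip F = S" unfolding module_adjoint_def
  proof (rule the_equality)
    show "is_adjoint ip F S" by (fact S)
    fix S' assume "is_adjoint ip F S'"
    then have "ip x (S' y) = ip x (S y)" for x y using S unfolding is_adjoint_def by metis
    then show "S' = S" by (metis eq_if_ip_eq ip_star ext)
  qed
  moreover have "is_adjoint ip S F" using S unfolding is_adjoint_def by (metis ip_star)
  ultimately show ?thesis unfolding adjointable_def by blast
qed

lemma bochner_ip_self_positive:
  assumes "has_bochner M (\<lambda>w. ip (u w) (u w)) I"
  shows "cstar_positive I"
  using has_bochner_in_closed_cone[OF assms, of "{a. cstar_positive a}"]
  by (simp add: ip_self_positive closed_cstar_positive cstar_positive_zero cstar_positive_add
      cstar_positive_scaleR)

text \<open>
  Square-integrability is stable under sums, because \<open>\<parallel>u + v\<parallel>\<^sup>2 \<le> 2 \<parallel>u\<parallel>\<^sup>2 + 2 \<parallel>v\<parallel>\<^sup>2\<close>.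
\<close>

lemma bochner_integrable_ip_self_add:
  assumes u: "strongly_measurable M u" "bochner_integrable M (\<lambda>w. ip (u w) (u w))"
    and v: "strongly_measurable M v" "bochner_integrable M (\<lambda>w. ip (v w) (v w))"
  shows "bochner_integrable M (\<lambda>w. ip (u w + v w) (u w + v w))"
proof (rule bochner_integrable_bounded)
  show "strongly_measurable M (\<lambda>w. ip (u w + v w) (u w + v w))"
    by (intro strongly_measurable_ip_self strongly_measurable_add u v)
  have fin: "(\<integral>\<^sup>+w. norm (2 *\<^sub>R ip (f w) (f w)) \<partial>M) < \<infinity>"
    if "bochner_integrable M (\<lambda>w. ip (f w) (f w))" for f
    using that has_bochner_bounded_linear[OF bounded_linear_scaleR_right[of 2]]
    by (intro nn_integral_norm_finite) (auto simp: bochner_integrable_def)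
  have "(\<integral>\<^sup>+w. norm (ip (u w + v w) (u w + v w)) \<partial>M) \<le>
      (\<integral>\<^sup>+w. norm (2 *\<^sub>R ip (u w) (u w)) \<partial>M) + (\<integral>\<^sup>+w. norm (2 *\<^sub>R ip (v w) (v w)) \<partial>M)"
  proof (rule nn_integral_norm_triangle)
    fix w
    have "(norm (u w + v w))\<^sup>2 \<le> (norm (u w) + norm (v w))\<^sup>2"
      by (intro power_mono norm_triangle_ineq) simp
    also have "\<dots> \<le> 2 * (norm (u w))\<^sup>2 + 2 * (norm (v w))\<^sup>2"
      using zero_le_power2[of "norm (u w) - norm (v w)"] by (simp add: power2_sum power2_diff)
    finally show "norm (ip (u w + v w) (u w + v w)) \<le>
        norm (2 *\<^sub>R ip (u w) (u w)) + norm (2 *\<^sub>R ip (v w) (v w))"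
      by (simp add: norm_ip_self)
  qed (intro strongly_measurable_bounded_linear[OF bounded_linear_scaleR_right]
      strongly_measurable_ip_self u v)+
  also have "\<dots> < \<infinity>" using fin[OF u(2)] fin[OF v(2)] by simp
  finally show "(\<integral>\<^sup>+w. norm (ip (u w + v w) (u w + v w)) \<partial>M) < \<infinity>" .
qed

text \<open>
  Minkowski's inequality for square-integrable families. Integrating
  \<open>|u + v|\<^sup>2 \<le> (1 + t) |u|\<^sup>2 + (1 + 1/t) |v|\<^sup>2\<close>, whose difference is
  \<open>|t^(1/2) u - t^(-1/2) v|\<^sup>2\<close>, and using monotonicity of the norm on positive elements, one gets a
  bound for \<open>\<parallel>W\<parallel>\<close> which for \<open>t = b / a\<close> becomes \<open>(a + b)\<^sup>2\<close>, where \<open>a\<close> and \<open>b\<close> stand for the two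
  square roots.
\<close>

lemma sqrt_norm_bochner_ip_add_le:
  assumes U: "has_bochner M (\<lambda>w. ip (u w) (u w)) U"
    and V: "has_bochner M (\<lambda>w. ip (v w) (v w)) V"
    and W: "has_bochner M (\<lambda>w. ip (u w + v w) (u w + v w)) W"
  shows "sqrt (norm W) \<le> sqrt (norm U) + sqrt (norm V)"
proof -
  have young: "norm W \<le> (1 + t) * norm U + (1 + 1 / t) * norm V" if t: "t > 0" for t
  proof -
    have "has_bochner M (\<lambda>w. ((1 + t) *\<^sub>R ip (u w) (u w) + (1 + 1 / t) *\<^sub>R ip (v w) (v w))
        + (-1) *\<^sub>R ip (u w + v w) (u w + v w)) (((1 + t) *\<^sub>R U + (1 + 1 / t) *\<^sub>R V) + (-1) *\<^sub>R W)"
      by (intro has_bochner_add has_bochner_bounded_linear[OF bounded_linear_scaleR_right] U V W)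
    also have "(\<lambda>w. ((1 + t) *\<^sub>R ip (u w) (u w) + (1 + 1 / t) *\<^sub>R ip (v w) (v w))
        + (-1) *\<^sub>R ip (u w + v w) (u w + v w)) =
      (\<lambda>w. ip (sqrt t *\<^sub>R u w - (1 / sqrt t) *\<^sub>R v w) (sqrt t *\<^sub>R u w - (1 / sqrt t) *\<^sub>R v w))"
      using t by (simp add: fun_eq_iff ip_add_left ip_add_right ip_diff_left ip_diff_right
        ip_scaleR_left ip_scaleR_right algebra_simps)
    finally have "cstar_positive (((1 + t) *\<^sub>R U + (1 + 1 / t) *\<^sub>R V) - W)"
      using bochner_ip_self_positive by fastforce
    then have "norm W \<le> norm ((1 + t) *\<^sub>R U + (1 + 1 / t) *\<^sub>R V)"
      by (intro cstar_positive_norm_mono) (rule bochner_ip_self_positive[OF W])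
    also have "\<dots> \<le> (1 + t) * norm U + (1 + 1 / t) * norm V"
      using norm_triangle_ineq[of "(1 + t) *\<^sub>R U" "(1 + 1 / t) *\<^sub>R V"] t by simp
    finally show ?thesis .
  qed
  show ?thesis
  proof (rule field_le_epsilon)
    fix e :: real assume e: "e > 0"
    \<comment> \<open>The square roots may vanish, so they are enlarged by \<open>e / 2\<close> before \<open>t = b / a\<close> is
      chosen.\<close>
    define a b where "a = sqrt (norm U) + e / 2" and "b = sqrt (norm V) + e / 2"
    have pos: "a > 0" "b > 0" using e by (simp_all add: a_def b_def add_nonneg_pos)
    have "norm U = (sqrt (norm U))\<^sup>2" by simp
    also have "\<dots> \<le> a\<^sup>2" using e by (intro power_mono) (auto simp: a_def)
    finally have aU: "norm U \<le> a\<^sup>2" .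
    have "norm V = (sqrt (norm V))\<^sup>2" by simp
    also have "\<dots> \<le> b\<^sup>2" using e by (intro power_mono) (auto simp: b_def)
    finally have bV: "norm V \<le> b\<^sup>2" .
    have "norm W \<le> (1 + b / a) * norm U + (1 + 1 / (b / a)) * norm V"
      using pos by (intro young) simp
    also have "\<dots> \<le> (1 + b / a) * a\<^sup>2 + (1 + 1 / (b / a)) * b\<^sup>2"
      using pos aU bV by (intro add_mono mult_left_mono) auto
    also have "\<dots> = (a + b)\<^sup>2" using pos by (simp add: field_simps power2_eq_square)
    finally have "sqrt (norm W) \<le> a + b" using pos by (intro real_le_lsqrt) auto
    then show "sqrt (norm W) \<le> sqrt (norm U) + sqrt (norm V) + e" by (simp add: a_def b_def)
  qed
qed

lemma bounded_linear_conj: "bounded_linear (\<lambda>y. c * y * star c)"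
  for c :: 'a
  by (rule bounded_linear_compose[OF bounded_linear_mult_left bounded_linear_mult_right])

lemma has_bochner_act:
  assumes "operator_family ip M F" "has_bochner M (\<lambda>w. ip (F w x) (F w x)) I"
  shows "has_bochner M (\<lambda>w. ip (F w (act c x)) (F w (act c x))) (c * I * star c)"
proof (rule has_bochner_cong)
  show "has_bochner M (\<lambda>w. c * ip (F w x) (F w x) * star c) (c * I * star c)"
    by (rule has_bochner_bounded_linear[OF bounded_linear_conj assms(2)])
  fix w assume "w \<in> space M"
  then have "F w (act c x) = act c (F w x)"
    using assms(1) adjointable_linear(2) unfolding operator_family_def by blast
  then show "c * ip (F w x) (F w x) * star c = ip (F w (act c x)) (F w (act c x))"
    by (simp add: ip_act_left ip_act_right mult.assoc)
qed

end


section \<open>Perturbation of continuous K-operator frames\<close>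

theorem theorem5p2:
  fixes act :: "'a::cstar_algebra \<Rightarrow> 'h::banach \<Rightarrow> 'h"
    and ip :: "'h \<Rightarrow> 'h \<Rightarrow> 'a"
    and M :: "'w measure"
    and K :: "'h \<Rightarrow> 'h"
    and T R :: "'w \<Rightarrow> 'h \<Rightarrow> 'h"
    and A B \<alpha> \<beta> :: real
  assumes "hilbert_module act ip"
    and "adjointable ip K"
    and "continuous_K_operator_frame ip M K T A B"
    and "operator_family ip M R"
    and "\<alpha> \<ge> 0" and "\<beta> \<ge> 0"
    and "0 \<le> \<alpha> + \<beta> / A" and "\<alpha> + \<beta> / A < 1"
    and "\<And>x. bochner_integrable M (\<lambda>w. ip (T w x - R w x) (T w x - R w x))"
    and "\<And>x. norm (bochner M (\<lambda>w. ip (T w x - R w x) (T w x - R w x)))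
          \<le> \<alpha> * norm (bochner M (\<lambda>w. ip (T w x) (T w x)))
            + \<beta> * norm (ip (module_adjoint ip K x) (module_adjoint ip K x))"
  shows "continuous_K_operator_frame ip M K R
    (A * (1 - sqrt (\<alpha> + \<beta> / A))\<^sup>2) (B * (1 + sqrt (\<alpha> + \<beta> / A))\<^sup>2)"
proof -
  interpret hilbert_module act ip by (fact assms(1))
  define L where "L = module_adjoint ip K"
  define QT where "QT x = bochner M (\<lambda>w. ip (T w x) (T w x))" for x
  define QR where "QR x = bochner M (\<lambda>w. ip (R w x) (R w x))" for x
  define QD where "QD x = bochner M (\<lambda>w. ip (T w x - R w x) (T w x - R w x))" for x
  define s where "s = sqrt (\<alpha> + \<beta> / A)"
  have s: "0 \<le> s" "s < 1" and s2: "s\<^sup>2 = \<alpha> + \<beta> / A"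
    using assms(7,8) by (simp_all add: s_def)
  have A: "A > 0" and B: "B > 0" and famT: "operator_family ip M T"
    and intT: "\<And>x. bochner_integrable M (\<lambda>w. ip (T w x) (T w x))"
    and lo: "\<And>x. cstar_positive (QT x - A *\<^sub>R ip (L x) (L x))"
    and hi: "\<And>x. cstar_positive (B *\<^sub>R ip x x - QT x)"
    using assms(3) unfolding continuous_K_operator_frame_def cstar_le_def QT_def L_def by auto
  have mT: "strongly_measurable M (\<lambda>w. T w x)" and mR: "strongly_measurable M (\<lambda>w. R w x)" for x
    using famT assms(4) unfolding operator_family_def by auto
  have hT: "has_bochner M (\<lambda>w. ip (T w x) (T w x)) (QT x)" for x
    unfolding QT_def by (rule has_bochner_bochner[OF intT])
  have hD: "has_bochner M (\<lambda>w. ip (T w x - R w x) (T w x - R w x)) (QD x)" for x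
    unfolding QD_def by (rule has_bochner_bochner[OF assms(9)])
  \<comment> \<open>\<open>R = T + (R - T)\<close> gives integrability and the upper bound, \<open>T = R + (T - R)\<close> the lower
    bound; the two differences have the same square.\<close>
  have flip: "(\<lambda>w. ip (R w x - T w x) (R w x - T w x)) = (\<lambda>w. ip (T w x - R w x) (T w x - R w x))" for x
    by (simp add: ip_diff_left ip_diff_right algebra_simps)
  have intR: "bochner_integrable M (\<lambda>w. ip (R w x) (R w x))" for x
    using bochner_integrable_ip_self_add[of M "\<lambda>w. T w x" "\<lambda>w. R w x - T w x"] assms(9)
    by (simp add: flip mT mR intT strongly_measurable_diff)
  have hR: "has_bochner M (\<lambda>w. ip (R w x) (R w x)) (QR x)" for x
    unfolding QR_def by (rule has_bochner_bochner[OF intR])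
  have nL: "A * norm (ip (L x) (L x)) \<le> norm (QT x)" for x
    using cstar_positive_norm_mono[OF cstar_positive_scaleR[OF ip_self_positive] lo, of x] A by simp
  have nT: "norm (QT x) \<le> B * norm (ip x x)" for x
    using cstar_positive_norm_mono[OF bochner_ip_self_positive[OF hT] hi, of x] B by simp
  have nD: "sqrt (norm (QD x)) \<le> s * sqrt (norm (QT x))" for x
  proof -
    have "norm (QD x) \<le> \<alpha> * norm (QT x) + \<beta> * norm (ip (L x) (L x))"
      unfolding QD_def QT_def L_def by (rule assms(10))
    also have "\<beta> * norm (ip (L x) (L x)) = \<beta> / A * (A * norm (ip (L x) (L x)))" using A by simp
    also have "\<dots> \<le> \<beta> / A * norm (QT x)" using A assms(6) nL by (intro mult_left_mono) auto
    finally have "norm (QD x) \<le> s\<^sup>2 * norm (QT x)" by (simp add: s2 algebra_simps)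
    then have "sqrt (norm (QD x)) \<le> sqrt (s\<^sup>2 * norm (QT x))" by (rule real_sqrt_le_mono)
    then show ?thesis using s by (simp add: real_sqrt_mult)
  qed
  have upper: "norm (QR x) \<le> (1 + s)\<^sup>2 * norm (QT x)" for x
  proof -
    have "sqrt (norm (QR x)) \<le> sqrt (norm (QT x)) + sqrt (norm (QD x))"
      using sqrt_norm_bochner_ip_add_le[of M "\<lambda>w. T w x" "QT x" "\<lambda>w. R w x - T w x" "QD x" "QR x"]
      by (simp add: flip hT hD hR)
    also have "\<dots> \<le> (1 + s) * sqrt (norm (QT x))" using nD[of x] by (simp add: algebra_simps)
    finally have "(sqrt (norm (QR x)))\<^sup>2 \<le> ((1 + s) * sqrt (norm (QT x)))\<^sup>2" by (intro power_mono) auto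
    then show ?thesis by (simp add: power_mult_distrib)
  qed
  have lower: "(1 - s)\<^sup>2 * norm (QT x) \<le> norm (QR x)" for x
  proof -
    have "sqrt (norm (QT x)) \<le> sqrt (norm (QR x)) + sqrt (norm (QD x))"
      using sqrt_norm_bochner_ip_add_le[of M "\<lambda>w. R w x" "QR x" "\<lambda>w. T w x - R w x" "QD x" "QT x"]
      by (simp add: hT hD hR)
    then have "(1 - s) * sqrt (norm (QT x)) \<le> sqrt (norm (QR x))" using nD[of x] by (simp add: algebra_simps)
    then have "((1 - s) * sqrt (norm (QT x)))\<^sup>2 \<le> (sqrt (norm (QR x)))\<^sup>2"
      using s by (intro power_mono) auto
    then show ?thesis by (simp add: power_mult_distrib)
  qed
  define A' B' where "A' = A * (1 - s)\<^sup>2" and "B' = B * (1 + s)\<^sup>2"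
  have AB: "A' > 0" "B' > 0" using A B s by (simp_all add: A'_def B'_def zero_less_mult_iff)
  \<comment> \<open>Both quadratic expressions transform by \<open>a \<mapsto> c a c\<^sup>*\<close> under \<open>x \<mapsto> c x\<close>, so that the norm
    inequalities at all \<open>c x\<close> give the inequality of the algebra at \<open>x\<close>.\<close>
  have QR_act: "QR (act c x) = c * QR x * star c" for c x
    using bochner_eqI[OF has_bochner_act[OF assms(4) hR]] unfolding QR_def .
  have L_act: "ip (L (act c x)) (L (act c x)) = c * ip (L x) (L x) * star c" for c x
    unfolding L_def adjointable_linear(2)[OF adjointable_module_adjoint[OF assms(2)]]
    by (simp add: ip_act_left ip_act_right mult.assoc)
  have posR: "cstar_positive (QR x)" for x by (rule bochner_ip_self_positive[OF hR])
  have "A' *\<^sub>R ip (L x) (L x) \<sqsubseteq>\<^sub>C QR x" for x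
  proof (rule cstar_le_if_conj_norm_le[OF posR cstar_positive_scaleR[OF ip_self_positive]])
    fix c :: 'a assume c: "star c = c"
    have "A' * norm (ip (L y) (L y)) \<le> norm (QR y)" for y
    proof -
      have "A' * norm (ip (L y) (L y)) = (1 - s)\<^sup>2 * (A * norm (ip (L y) (L y)))" by (simp add: A'_def)
      also have "\<dots> \<le> (1 - s)\<^sup>2 * norm (QT y)" by (intro mult_left_mono nL) simp
      finally show ?thesis using lower[of y] by linarith
    qed
    from this[of "act c x"] show "norm (c * (A' *\<^sub>R ip (L x) (L x)) * c) \<le> norm (c * QR x * c)"
      using AB by (simp add: L_act QR_act c)
  qed (use AB in auto)
  moreover have "QR x \<sqsubseteq>\<^sub>C B' *\<^sub>R ip x x" for x
  proof (rule cstar_le_if_conj_norm_le[OF cstar_positive_scaleR[OF ip_self_positive] posR])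
    fix c :: 'a assume c: "star c = c"
    have "norm (QR y) \<le> B' * norm (ip y y)" for y
    proof -
      have "norm (QR y) \<le> (1 + s)\<^sup>2 * (B * norm (ip y y))"
        using upper[of y] mult_left_mono[OF nT, of "(1 + s)\<^sup>2" y] by simp
      then show ?thesis by (simp add: B'_def algebra_simps)
    qed
    from this[of "act c x"] show "norm (c * QR x * c) \<le> norm (c * (B' *\<^sub>R ip x x) * c)"
      using AB by (simp add: QR_act ip_act_left ip_act_right c mult.assoc)
  qed (use AB in auto)
  ultimately show ?thesis
    using AB intR assms(4)
    unfolding continuous_K_operator_frame_def QR_def L_def A'_def B'_def s_def by blast
qed

end
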